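(* Let $\gamma:I\to\mathbb{G}$ be a unit speed Frenet curve with Frenet-Serret apparatus $\{T,N,B,\kappa,\tau\}$, and let $\beta$ be its natural mate in $\mathbb{G}$. If $\tau-\tau_{\mathbb G}=c$ is a nonzero constant, where $\tau_{\mathbb G}=\frac12\langle[T,N],B\rangle$, then $\beta$ is a spherical curve whose left shift lies on a sphere of radius $1/|c|$ in $\mathfrak g$.
   Context: Let $\mathbb{G}$ be a three-dimensional Lie group with a bi-invariant Riemannian metric $\langle\cdot,\cdot\rangle$, with (oriented) Lie algebra $\mathfrak g$ and Levi-Civita connection $\nabla$; $I\subset\mathbb R$ is an interval and curves are smooth. Vector fields along a curve in $\mathbb G$ are identified with $\mathfrak g$-valued maps by left translation: fixing an orthonormal basis $X_1,X_2,X_3$ of left-invariant fields, write $U=\sum u_iX_i$, and set $U'=\sum u_i'X_i$, $[U,V]=\sum u_iv_j[X_i,X_j]$; then $\nabla_TU=U'+\frac12[T,U]$ with $T=\gamma'$. Vector fields along different curves with the same parameter interval are compared as $\mathfrak g$-valued maps. A unit speed curve $\gamma$ has Frenet-Serret apparatus $\{T,N,B,\kappa,\tau\}$ if $\kappa=\|\nabla_TT\|>0$, $(T,N,B)$ is a positively oriented orthonormal frame, and $\nabla_TT=\kappa N$, $\nabla_TN=-\kappa T+\tau B$, $\nabla_TB=-\tau N$. It is a Frenet curve if moreover $\tau\neq0$. A unit speed curve $\beta:I\to\mathbb G$ with Frenet-Serret apparatus $\{\overline T,\overline N,\overline B,\overline\kappa,\overline\tau\}$ is the natural mate of $\gamma$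 if $\overline T=N$. A left shift of a curve $\beta:I\to\mathbb G$ is a curve $\alpha:I\to\mathfrak g$ with $\alpha'(s)=dL_{\beta(s)^{-1}}\beta'(s)$ for all $s$; it exists and is unique up to the initial condition (a translation of $\mathfrak g$). $\beta$ is a spherical curve whose left shift lies on a sphere of radius $r$ if some left shift satisfies $\langle\alpha,\alpha\rangle=r^2$ on $I$. *)

theory Defs
  imports "HOL-Analysis.Analysis" "HOL-Algebra.Group"
begin

section \<open>Smooth manifolds\<close>

text \<open>Derivatives are taken within the set \<open>S\<close>. This is the usual notion of a smooth map whenever
  derivatives within \<open>S\<close> are unique, in particular for open sets and for nondegenerate
  (not necessarily open) intervals of the real line, the only cases used below.\<close>

primrec Ck_on :: "nat \<Rightarrow> 'a::euclidean_space set \<Rightarrow> ('a \<Rightarrow> 'b::euclidean_space) \<Rightarrow> bool" where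
  "Ck_on 0 S f \<longleftrightarrow> continuous_on S f"
| "Ck_on (Suc n) S f \<longleftrightarrow>
     (\<exists>f'. (\<forall>x\<in>S. (f has_derivative f' x) (at x within S)) \<and> (\<forall>v. Ck_on n S (\<lambda>x. f' x v)))"

definition smooth_on :: "'a::euclidean_space set \<Rightarrow> ('a \<Rightarrow> 'b::euclidean_space) \<Rightarrow> bool" where
  "smooth_on S f \<longleftrightarrow> (\<forall>n. Ck_on n S f)"

type_synonym ('g, 'e) chart = "'g set \<times> ('g \<Rightarrow> 'e)"

definition chart_inv :: "('g, 'e) chart \<Rightarrow> 'e \<Rightarrow> 'g" where
  "chart_inv c = inv_into (fst c) (snd c)"

definition smooth_atlas ::
  "('g::topological_space, 'e::euclidean_space) chart set \<Rightarrow> bool" where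
  "smooth_atlas A \<longleftrightarrow>
     (\<forall>c\<in>A. open (fst c) \<and> open (snd c ` fst c) \<and>
            homeomorphism (fst c) (snd c ` fst c) (snd c) (chart_inv c)) \<and>
     (\<Union>c\<in>A. fst c) = UNIV \<and>
     (\<forall>c\<in>A. \<forall>d\<in>A. smooth_on (snd c ` (fst c \<inter> fst d)) (snd d \<circ> chart_inv c))"

definition smooth_map ::
  "('g::topological_space, 'e::euclidean_space) chart set \<Rightarrow>
   ('h::topological_space, 'f::euclidean_space) chart set \<Rightarrow> ('g \<Rightarrow> 'h) \<Rightarrow> bool" where
  "smooth_map A A' f \<longleftrightarrow> continuous_on UNIV f \<and>
     (\<forall>c\<in>A. \<forall>d\<in>A'. smooth_on (snd c ` (fst c \<inter> f -` fst d)) (snd d \<circ> f \<circ> chart_inv c))"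

definition prod_atlas ::
  "('g, 'e) chart set \<Rightarrow> ('h, 'f) chart set \<Rightarrow> ('g \<times> 'h, 'e \<times> 'f) chart set" where
  "prod_atlas A A' = {(fst c \<times> fst d, map_prod (snd c) (snd d)) | c d. c \<in> A \<and> d \<in> A'}"

definition real_atlas :: "(real, real) chart set" where
  "real_atlas = {(UNIV, \<lambda>x. x)}"

text \<open>The tangent space at \<open>p\<close> is the model space \<open>'e\<close>, read through one chart \<open>chart_at A p\<close>
  chosen once and for all for each point.\<close>

definition chart_at :: "('g, 'e) chart set \<Rightarrow> 'g \<Rightarrow> ('g, 'e) chart" where
  "chart_at A p = (SOME c. c \<in> A \<and> p \<in> fst c)"

definition tangent_map ::
  "('g, 'e::euclidean_space) chart set \<Rightarrow> ('h, 'f::euclidean_space) chart set \<Rightarrow>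
   ('g \<Rightarrow> 'h) \<Rightarrow> 'g \<Rightarrow> 'e \<Rightarrow> 'f" where
  "tangent_map A A' f p =
     frechet_derivative (snd (chart_at A' (f p)) \<circ> f \<circ> chart_inv (chart_at A p))
       (at (snd (chart_at A p) p))"

text \<open>A vector field is a map \<open>X :: 'g \<Rightarrow> 'e\<close>, where \<open>X p\<close> is a tangent vector at \<open>p\<close> in the sense
  above (so it is expressed in \<open>chart_at A p\<close>); \<open>field_in_chart A c X\<close> is its expression
  in the chart \<open>c\<close>.\<close>

definition field_in_chart ::
  "('g, 'e::euclidean_space) chart set \<Rightarrow> ('g, 'e) chart \<Rightarrow> ('g \<Rightarrow> 'e) \<Rightarrow> 'e \<Rightarrow> 'e" where
  "field_in_chart A c X x =
     (let p = chart_inv c x in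
        frechet_derivative (snd c \<circ> chart_inv (chart_at A p)) (at (snd (chart_at A p) p)) (X p))"

definition smooth_field ::
  "('g, 'e::euclidean_space) chart set \<Rightarrow> ('g \<Rightarrow> 'e) \<Rightarrow> bool" where
  "smooth_field A X \<longleftrightarrow> (\<forall>c\<in>A. smooth_on (snd c ` fst c) (field_in_chart A c X))"

definition dir_deriv ::
  "('g, 'e::euclidean_space) chart set \<Rightarrow> ('g \<Rightarrow> 'e) \<Rightarrow> ('g \<Rightarrow> real) \<Rightarrow> 'g \<Rightarrow> real" where
  "dir_deriv A X f p = tangent_map A real_atlas f p (X p)"

text \<open>In coordinates \<open>[X, Y] = DY(X) - DX(Y)\<close>, that is, \<open>[X, Y] f = X (Y f) - Y (X f)\<close>.\<close>

definition lie_bracket ::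
  "('g, 'e::euclidean_space) chart set \<Rightarrow> ('g \<Rightarrow> 'e) \<Rightarrow> ('g \<Rightarrow> 'e) \<Rightarrow> 'g \<Rightarrow> 'e" where
  "lie_bracket A X Y p =
     (let c = chart_at A p in
        frechet_derivative (field_in_chart A c Y) (at (snd c p)) (X p)
      - frechet_derivative (field_in_chart A c X) (at (snd c p)) (Y p))"

section \<open>Riemannian metrics and the Levi-Civita connection\<close>

text \<open>The last conjunct says that the components of the metric in every chart are smooth.\<close>

definition riemannian_metric ::
  "('g::topological_space, 'e::euclidean_space) chart set \<Rightarrow> ('g \<Rightarrow> 'e \<Rightarrow> 'e \<Rightarrow> real) \<Rightarrow> bool" where
  "riemannian_metric A g \<longleftrightarrow>
     (\<forall>p. bilinear (g p) \<and> (\<forall>v w. g p v w = g p w v) \<and> (\<forall>v. v \<noteq> 0 \<longrightarrow> g p v v > 0)) \<and>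
     (\<forall>c\<in>A. \<forall>v w. smooth_on (snd c ` fst c)
        (\<lambda>x. let p = chart_inv c x;
                 D = frechet_derivative (snd (chart_at A p) \<circ> chart_inv c) (at x)
             in g p (D v) (D w)))"

definition levi_civita ::
  "('g::topological_space, 'e::euclidean_space) chart set \<Rightarrow> ('g \<Rightarrow> 'e \<Rightarrow> 'e \<Rightarrow> real) \<Rightarrow>
   (('g \<Rightarrow> 'e) \<Rightarrow> ('g \<Rightarrow> 'e) \<Rightarrow> 'g \<Rightarrow> 'e) \<Rightarrow> bool" where
  "levi_civita A g nabla \<longleftrightarrow>
     (\<forall>X Y. smooth_field A X \<and> smooth_field A Y \<longrightarrow>
        smooth_field A (nabla X Y) \<and>
        (\<forall>p. nabla X Y p - nabla Y X p = lie_bracket A X Y p) \<and>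
        (\<forall>f p. smooth_map A real_atlas f \<longrightarrow>
           nabla (\<lambda>q. f q *\<^sub>R X q) Y p = f p *\<^sub>R nabla X Y p \<and>
           nabla X (\<lambda>q. f q *\<^sub>R Y q) p = dir_deriv A X f p *\<^sub>R Y p + f p *\<^sub>R nabla X Y p) \<and>
        (\<forall>Z p. smooth_field A Z \<longrightarrow>
           nabla (\<lambda>q. X q + Z q) Y p = nabla X Y p + nabla Z Y p \<and>
           nabla X (\<lambda>q. Y q + Z q) p = nabla X Y p + nabla X Z p \<and>
           dir_deriv A X (\<lambda>q. g q (Y q) (Z q)) p =
             g p (nabla X Y p) (Z p) + g p (Y p) (nabla X Z p)))"

section \<open>Lie groups\<close>

record ('g, 'e) lie_group_data = "'g monoid" +
  atlas :: "('g, 'e) chart set"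

definition lie_group ::
  "('g::{t2_space, second_countable_topology}, 'e::euclidean_space) lie_group_data \<Rightarrow> bool" where
  "lie_group G \<longleftrightarrow>
     group G \<and> carrier G = UNIV \<and> smooth_atlas (atlas G) \<and>
     smooth_map (prod_atlas (atlas G) (atlas G)) (atlas G) (\<lambda>(x, y). x \<otimes>\<^bsub>G\<^esub> y) \<and>
     smooth_map (atlas G) (atlas G) (\<lambda>x. inv\<^bsub>G\<^esub> x)"

definition bi_invariant_metric ::
  "('g::topological_space, 'e::euclidean_space) lie_group_data \<Rightarrow>
   ('g \<Rightarrow> 'e \<Rightarrow> 'e \<Rightarrow> real) \<Rightarrow> bool" where
  "bi_invariant_metric G g \<longleftrightarrow>
     riemannian_metric (atlas G) g \<and>
     (\<forall>a p v w.
        (let dL = tangent_map (atlas G) (atlas G) (\<lambda>x. a \<otimes>\<^bsub>G\<^esub> x) p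
         in g (a \<otimes>\<^bsub>G\<^esub> p) (dL v) (dL w) = g p v w) \<and>
        (let dR = tangent_map (atlas G) (atlas G) (\<lambda>x. x \<otimes>\<^bsub>G\<^esub> a) p
         in g (p \<otimes>\<^bsub>G\<^esub> a) (dR v) (dR w) = g p v w))"

text \<open>The Lie algebra is the tangent space at \<open>\<one>\<close>, with the bracket of left-invariant fields.
  \<open>to_algebra G p\<close> is the differential at \<open>p\<close> of the left translation by the inverse of \<open>p\<close>.\<close>

definition left_invariant_field ::
  "('g, 'e::euclidean_space) lie_group_data \<Rightarrow> 'e \<Rightarrow> 'g \<Rightarrow> 'e" where
  "left_invariant_field G v p = tangent_map (atlas G) (atlas G) (\<lambda>x. p \<otimes>\<^bsub>G\<^esub> x) \<one>\<^bsub>G\<^esub> v"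

definition to_algebra ::
  "('g, 'e::euclidean_space) lie_group_data \<Rightarrow> 'g \<Rightarrow> 'e \<Rightarrow> 'e" where
  "to_algebra G p = tangent_map (atlas G) (atlas G) (\<lambda>x. inv\<^bsub>G\<^esub> p \<otimes>\<^bsub>G\<^esub> x) p"

definition algebra_bracket ::
  "('g, 'e::euclidean_space) lie_group_data \<Rightarrow> 'e \<Rightarrow> 'e \<Rightarrow> 'e" where
  "algebra_bracket G u v =
     lie_bracket (atlas G) (left_invariant_field G u) (left_invariant_field G v) \<one>\<^bsub>G\<^esub>"

section \<open>Curves\<close>

definition smooth_curve ::
  "('g::topological_space, 'e::euclidean_space) chart set \<Rightarrow> real set \<Rightarrow> (real \<Rightarrow> 'g) \<Rightarrow> bool" where
  "smooth_curve A I \<gamma> \<longleftrightarrow> continuous_on I \<gamma> \<and>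
     (\<forall>c\<in>A. smooth_on (I \<inter> \<gamma> -` fst c) (snd c \<circ> \<gamma>))"

definition velocity ::
  "('g, 'e::euclidean_space) chart set \<Rightarrow> real set \<Rightarrow> (real \<Rightarrow> 'g) \<Rightarrow> real \<Rightarrow> 'e" where
  "velocity A I \<gamma> t = vector_derivative (snd (chart_at A (\<gamma> t)) \<circ> \<gamma>) (at t within I)"

definition unit_speed_curve ::
  "('g::topological_space, 'e::euclidean_space) lie_group_data \<Rightarrow> ('g \<Rightarrow> 'e \<Rightarrow> 'e \<Rightarrow> real) \<Rightarrow>
   real set \<Rightarrow> (real \<Rightarrow> 'g) \<Rightarrow> bool" where
  "unit_speed_curve G g I \<gamma> \<longleftrightarrow> smooth_curve (atlas G) I \<gamma> \<and>
     (\<forall>t\<in>I. g (\<gamma> t) (velocity (atlas G) I \<gamma> t) (velocity (atlas G) I \<gamma> t) = 1)"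

definition algebra_velocity ::
  "('g, 'e::euclidean_space) lie_group_data \<Rightarrow> real set \<Rightarrow> (real \<Rightarrow> 'g) \<Rightarrow> real \<Rightarrow> 'e" where
  "algebra_velocity G I \<gamma> t = to_algebra G (\<gamma> t) (velocity (atlas G) I \<gamma> t)"

text \<open>Covariant derivative along \<open>\<gamma>\<close>, in the direction of its velocity, of a vector field along
  \<open>\<gamma>\<close> given as an algebra-valued map \<open>U\<close>. For a basis \<open>X\<^sub>i\<close> of left-invariant fields and
  \<open>U = \<Sum> u\<^sub>i X\<^sub>i\<close> it is the usual \<open>\<Sum> u\<^sub>i' X\<^sub>i + \<Sum> u\<^sub>i \<nabla>\<^sub>T X\<^sub>i\<close>; the second sum is the value at
  \<open>\<gamma> t\<close> of the covariant derivative of the left-invariant field through \<open>U t\<close> along the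
  left-invariant field through \<open>T t\<close>.\<close>

definition cov_deriv_along ::
  "('g, 'e::euclidean_space) lie_group_data \<Rightarrow> (('g \<Rightarrow> 'e) \<Rightarrow> ('g \<Rightarrow> 'e) \<Rightarrow> 'g \<Rightarrow> 'e) \<Rightarrow>
   real set \<Rightarrow> (real \<Rightarrow> 'g) \<Rightarrow> (real \<Rightarrow> 'e) \<Rightarrow> real \<Rightarrow> 'e" where
  "cov_deriv_along G nabla I \<gamma> U t =
     vector_derivative U (at t within I) +
     to_algebra G (\<gamma> t)
       (nabla (left_invariant_field G (algebra_velocity G I \<gamma> t))
              (left_invariant_field G (U t)) (\<gamma> t))"

section \<open>Frenet curves in three-dimensional Lie groups\<close>

text \<open>An orientation of the Lie algebra is given by an ordered basis, the rows of \<open>E\<close>.\<close>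

definition positively_oriented :: "real^3^3 \<Rightarrow> real^3 \<Rightarrow> real^3 \<Rightarrow> real^3 \<Rightarrow> bool" where
  "positively_oriented E u v w \<longleftrightarrow> det (vector [u, v, w]) * det E > 0"

text \<open>The fields \<open>T\<close>, \<open>N\<close>, \<open>B\<close> along \<open>\<gamma>\<close> are algebra-valued maps and \<open>g \<one>\<close> is the inner product
  of the Lie algebra. Smoothness is explicit because \<open>vector_derivative\<close> is meaningless
  for a map that is not differentiable.\<close>

definition frenet_apparatus ::
  "('g::topological_space, real^3) lie_group_data \<Rightarrow> ('g \<Rightarrow> real^3 \<Rightarrow> real^3 \<Rightarrow> real) \<Rightarrow>
   (('g \<Rightarrow> real^3) \<Rightarrow> ('g \<Rightarrow> real^3) \<Rightarrow> 'g \<Rightarrow> real^3) \<Rightarrow> real^3^3 \<Rightarrow>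
   real set \<Rightarrow> (real \<Rightarrow> 'g) \<Rightarrow>
   (real \<Rightarrow> real^3) \<Rightarrow> (real \<Rightarrow> real^3) \<Rightarrow> (real \<Rightarrow> real^3) \<Rightarrow>
   (real \<Rightarrow> real) \<Rightarrow> (real \<Rightarrow> real) \<Rightarrow> bool" where
  "frenet_apparatus G g nabla E I \<gamma> T N B \<kappa> \<tau> \<longleftrightarrow>
     smooth_on I T \<and> smooth_on I N \<and> smooth_on I B \<and>
     (\<forall>t\<in>I.
        T t = algebra_velocity G I \<gamma> t \<and>
        \<kappa> t = sqrt (g \<one>\<^bsub>G\<^esub> (cov_deriv_along G nabla I \<gamma> T t) (cov_deriv_along G nabla I \<gamma> T t)) \<and>
        \<kappa> t > 0 \<and>
        g \<one>\<^bsub>G\<^esub> (T t) (T t) = 1 \<and> g \<one>\<^bsub>G\<^esub> (N t) (N t) = 1 \<and> g \<one>\<^bsub>G\<^esub> (B t) (B t) = 1 \<and>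
        g \<one>\<^bsub>G\<^esub> (T t) (N t) = 0 \<and> g \<one>\<^bsub>G\<^esub> (T t) (B t) = 0 \<and> g \<one>\<^bsub>G\<^esub> (N t) (B t) = 0 \<and>
        positively_oriented E (T t) (N t) (B t) \<and>
        cov_deriv_along G nabla I \<gamma> T t = \<kappa> t *\<^sub>R N t \<and>
        cov_deriv_along G nabla I \<gamma> N t = - \<kappa> t *\<^sub>R T t + \<tau> t *\<^sub>R B t \<and>
        cov_deriv_along G nabla I \<gamma> B t = - \<tau> t *\<^sub>R N t)"

definition frenet_curve ::
  "('g::topological_space, real^3) lie_group_data \<Rightarrow> ('g \<Rightarrow> real^3 \<Rightarrow> real^3 \<Rightarrow> real) \<Rightarrow>
   (('g \<Rightarrow> real^3) \<Rightarrow> ('g \<Rightarrow> real^3) \<Rightarrow> 'g \<Rightarrow> real^3) \<Rightarrow> real^3^3 \<Rightarrow>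
   real set \<Rightarrow> (real \<Rightarrow> 'g) \<Rightarrow>
   (real \<Rightarrow> real^3) \<Rightarrow> (real \<Rightarrow> real^3) \<Rightarrow> (real \<Rightarrow> real^3) \<Rightarrow>
   (real \<Rightarrow> real) \<Rightarrow> (real \<Rightarrow> real) \<Rightarrow> bool" where
  "frenet_curve G g nabla E I \<gamma> T N B \<kappa> \<tau> \<longleftrightarrow>
     unit_speed_curve G g I \<gamma> \<and> frenet_apparatus G g nabla E I \<gamma> T N B \<kappa> \<tau> \<and>
     (\<forall>t\<in>I. \<tau> t \<noteq> 0)"

text \<open>Being a natural mate depends on the original curve only through its principal normal \<open>N\<close>.\<close>

definition natural_mate ::
  "('g::topological_space, real^3) lie_group_data \<Rightarrow> ('g \<Rightarrow> real^3 \<Rightarrow> real^3 \<Rightarrow> real) \<Rightarrow>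
   (('g \<Rightarrow> real^3) \<Rightarrow> ('g \<Rightarrow> real^3) \<Rightarrow> 'g \<Rightarrow> real^3) \<Rightarrow> real^3^3 \<Rightarrow>
   real set \<Rightarrow> (real \<Rightarrow> real^3) \<Rightarrow> (real \<Rightarrow> 'g) \<Rightarrow> bool" where
  "natural_mate G g nabla E I N \<beta> \<longleftrightarrow>
     unit_speed_curve G g I \<beta> \<and>
     (\<exists>T' N' B' \<kappa>' \<tau>'. frenet_apparatus G g nabla E I \<beta> T' N' B' \<kappa>' \<tau>' \<and> (\<forall>t\<in>I. T' t = N t))"

definition group_torsion ::
  "('g, real^3) lie_group_data \<Rightarrow> ('g \<Rightarrow> real^3 \<Rightarrow> real^3 \<Rightarrow> real) \<Rightarrow>
   (real \<Rightarrow> real^3) \<Rightarrow> (real \<Rightarrow> real^3) \<Rightarrow> (real \<Rightarrow> real^3) \<Rightarrow> real \<Rightarrow> real" where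
  "group_torsion G g T N B t = g \<one>\<^bsub>G\<^esub> (algebra_bracket G (T t) (N t)) (B t) / 2"

definition left_shift ::
  "('g, 'e::euclidean_space) lie_group_data \<Rightarrow> real set \<Rightarrow> (real \<Rightarrow> 'g) \<Rightarrow> (real \<Rightarrow> 'e) \<Rightarrow> bool" where
  "left_shift G I \<beta> \<alpha> \<longleftrightarrow> smooth_on I \<alpha> \<and>
     (\<forall>s\<in>I. (\<alpha> has_vector_derivative algebra_velocity G I \<beta> s) (at s within I))"

definition spherical_with_radius ::
  "('g, 'e::euclidean_space) lie_group_data \<Rightarrow> ('g \<Rightarrow> 'e \<Rightarrow> 'e \<Rightarrow> real) \<Rightarrow>
   real set \<Rightarrow> (real \<Rightarrow> 'g) \<Rightarrow> real \<Rightarrow> bool" where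
  "spherical_with_radius G g I \<beta> r \<longleftrightarrow>
     (\<exists>\<alpha>. left_shift G I \<beta> \<alpha> \<and> (\<forall>s\<in>I. g \<one>\<^bsub>G\<^esub> (\<alpha> s) (\<alpha> s) = r\<^sup>2))"

end

theory Submission
  imports Defs
begin

text \<open>The Frenet equation \<open>\<nabla>\<^sub>T B = - \<tau> N\<close> reads \<open>B' + [T, B]/2 = - \<tau> N\<close> in the left trivialisation.
  For a bi-invariant metric the bracket is skew, so \<open>[T, B]\<close> is orthogonal to \<open>T\<close> and \<open>B\<close>, while
  \<open>\<langle>[T, B], N\<rangle> = - \<langle>[T, N], B\<rangle> = - 2 \<tau>\<^sub>G\<close>; in dimension three this means
  \<open>[T, B] = - 2 \<tau>\<^sub>G N\<close>. Hence \<open>B' = - (\<tau> - \<tau>\<^sub>G) N = - c N\<close>. Since the left-trivialised velocity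
  of the natural mate is \<open>N\<close>, the curve \<open>- B / c\<close> is a left shift of it, and it has constant norm
  \<open>1 / \<bar>c\<bar>\<close>.

  What needs work is the formula \<open>\<nabla>\<^sub>X Y = [X, Y]/2\<close> for left-invariant fields, derived from the
  definition of a Lie group by charts. It rests on three facts.
  The bracket of left-invariant fields is left-invariant (\<open>lie_bracket_left_invariant\<close>): brackets
  are natural under \<open>L\<^sub>p\<close>, because the second derivative of a smooth map is symmetric.
  The bracket on the Lie algebra is skew (\<open>bracket_skew\<close>): this compares the left-invariant and
  the right-invariant frames to first order at the identity, using that both are isometric and that
  the difference of their derivatives there is the bracket.
  Finally, the Koszul computation on left-invariant fields, whose mutual scalar products are
  constant, gives \<open>levi_civita_left_invariant\<close>.\<close>

section \<open>Smooth maps and second derivatives\<close>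

lemma Ck_on_cong:
  assumes "\<And>x. x \<in> S \<Longrightarrow> f x = g x"
  shows "Ck_on n S f \<longleftrightarrow> Ck_on n S g"
proof (cases n)
  case 0
  then show ?thesis using assms by (simp cong: continuous_on_cong)
next
  case (Suc m)
  have "(f has_derivative D) (at x within S) \<longleftrightarrow> (g has_derivative D) (at x within S)"
    if "x \<in> S" for x D
    using that assms by (metis has_derivative_transform)
  then show ?thesis unfolding Suc Ck_on.simps by (simp cong: ball_cong)
qed

lemma smooth_on_cong:
  assumes "\<And>x. x \<in> S \<Longrightarrow> f x = g x"
  shows "smooth_on S f \<longleftrightarrow> smooth_on S g"
  by (simp only: smooth_on_def Ck_on_cong[of S f g, OF assms])

lemma Ck_on_compose_affine:
  fixes f :: "'b::euclidean_space \<Rightarrow> 'c::euclidean_space"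
    and L :: "'a::euclidean_space \<Rightarrow> 'b"
  assumes L: "bounded_linear L" and sub: "\<And>x. x \<in> S \<Longrightarrow> L x + b \<in> W"
  shows "Ck_on n W f \<Longrightarrow> Ck_on n S (\<lambda>x. f (L x + b))"
proof (induction n arbitrary: f)
  case 0
  have "continuous_on S (\<lambda>x. L x + b)"
    using L by (intro continuous_intros linear_continuous_on)
  then show ?case
    using 0 sub by (auto intro: continuous_on_compose2)
next
  case (Suc n)
  then obtain f' where f': "\<And>x. x \<in> W \<Longrightarrow> (f has_derivative f' x) (at x within W)"
    and Ck: "\<And>v. Ck_on n W (\<lambda>x. f' x v)" by auto
  have aff: "((\<lambda>x. L x + b) has_derivative L) (at x within S)" for x
    using L by (auto intro!: derivative_eq_intros bounded_linear_imp_has_derivative)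
  have "((\<lambda>x. f (L x + b)) has_derivative (\<lambda>v. f' (L x + b) (L v))) (at x within S)" if "x \<in> S" for x
    by (rule has_derivative_in_compose2[of W f f', OF f' _ that aff]) (use sub in auto)
  then show ?case
    using Suc.IH[OF Ck] by (auto intro!: exI[of _ "\<lambda>x v. f' (L x + b) (L v)"])
qed

lemma smooth_on_compose_affine:
  fixes f :: "'b::euclidean_space \<Rightarrow> 'c::euclidean_space"
    and L :: "'a::euclidean_space \<Rightarrow> 'b"
  assumes "smooth_on W f" "bounded_linear L" "\<And>x. x \<in> S \<Longrightarrow> L x + b \<in> W"
  shows "smooth_on S (\<lambda>x. f (L x + b))"
  unfolding smooth_on_def
proof
  fix n
  have "Ck_on n W f" using assms(1) unfolding smooth_on_def by simp
  then show "Ck_on n S (\<lambda>x. f (L x + b))"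
    using Ck_on_compose_affine[of L S b W n f, OF assms(2,3)] by simp
qed

lemma smooth_on_slice_fst:
  fixes f :: "'a::euclidean_space \<times> 'b::euclidean_space \<Rightarrow> 'c::euclidean_space"
  assumes "smooth_on W f" "\<And>x. x \<in> S \<Longrightarrow> (x, b) \<in> W"
  shows "smooth_on S (\<lambda>x. f (x, b))"
  using smooth_on_compose_affine[of W f "\<lambda>x. (x, 0)" S "(0, b)"] assms
  by (simp add: bounded_linear_Pair bounded_linear_ident bounded_linear_zero)

lemma smooth_on_slice_snd:
  fixes f :: "'a::euclidean_space \<times> 'b::euclidean_space \<Rightarrow> 'c::euclidean_space"
  assumes "smooth_on W f" "\<And>y. y \<in> S \<Longrightarrow> (a, y) \<in> W"
  shows "smooth_on S (\<lambda>y. f (a, y))"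
  using smooth_on_compose_affine[of W f "\<lambda>y. (0, y)" S "(a, 0)"] assms
  by (simp add: bounded_linear_Pair bounded_linear_ident bounded_linear_zero)

lemma Ck_on_scaleR_const:
  fixes f :: "'a::euclidean_space \<Rightarrow> 'b::euclidean_space"
  shows "Ck_on n S f \<Longrightarrow> Ck_on n S (\<lambda>x. k *\<^sub>R f x)"
proof (induction n arbitrary: f)
  case 0
  then show ?case by (auto intro: continuous_intros)
next
  case (Suc n)
  then obtain f' where f': "\<And>x. x \<in> S \<Longrightarrow> (f has_derivative f' x) (at x within S)"
    and Ck: "\<And>v. Ck_on n S (\<lambda>x. f' x v)" by auto
  have "((\<lambda>x. k *\<^sub>R f x) has_derivative (\<lambda>v. k *\<^sub>R f' x v)) (at x within S)" if "x \<in> S" for x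
    by (intro has_derivative_scaleR_right f' that)
  then show ?case
    using Suc.IH[OF Ck] by (auto intro!: exI[of _ "\<lambda>x v. k *\<^sub>R f' x v"])
qed

lemma smooth_on_scaleR_const:
  fixes f :: "'a::euclidean_space \<Rightarrow> 'b::euclidean_space"
  shows "smooth_on S f \<Longrightarrow> smooth_on S (\<lambda>x. k *\<^sub>R f x)"
  by (simp add: smooth_on_def Ck_on_scaleR_const)

lemma smooth_on_imp_differentiable:
  assumes "smooth_on S f" "x \<in> S"
  shows "f differentiable (at x within S)"
proof -
  have "Ck_on (Suc 0) S f" using assms(1) unfolding smooth_on_def by blast
  then show ?thesis using assms(2) unfolding differentiable_def by auto
qed

lemma smooth_on_imp_continuous_on:
  assumes "smooth_on S f"
  shows "continuous_on S f"
proof -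
  have "Ck_on 0 S f" using assms unfolding smooth_on_def by blast
  then show ?thesis by simp
qed

lemma smooth_on_has_derivative:
  assumes "smooth_on S f" "open S" "x \<in> S"
  shows "(f has_derivative frechet_derivative f (at x)) (at x)"
  using smooth_on_imp_differentiable[OF assms(1,3)]
  unfolding at_within_open[OF assms(3,2)] frechet_derivative_works .

lemma smooth_on_derivative:
  fixes f :: "'a::euclidean_space \<Rightarrow> 'b::euclidean_space"
  assumes f: "smooth_on S f" and S: "open S"
  shows "smooth_on S (\<lambda>x. frechet_derivative f (at x) v)"
  unfolding smooth_on_def
proof
  fix n
  have "Ck_on (Suc n) S f" using f unfolding smooth_on_def by blast
  then obtain f' where f': "\<And>x. x \<in> S \<Longrightarrow> (f has_derivative f' x) (at x within S)"
    and Ck: "Ck_on n S (\<lambda>x. f' x v)" by auto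
  have "frechet_derivative f (at x) v = f' x v" if "x \<in> S" for x
    using f'[OF that] unfolding at_within_open[OF that S]
    by (simp add: frechet_derivative_at[symmetric])
  then show "Ck_on n S (\<lambda>x. frechet_derivative f (at x) v)"
    using Ck Ck_on_cong[of S "\<lambda>x. frechet_derivative f (at x) v" "\<lambda>x. f' x v"] by blast
qed

lemma has_vector_derivative_along_line:
  assumes "(f has_derivative f') (at (y + s *\<^sub>R z))"
  shows "((\<lambda>s. f (y + s *\<^sub>R z)) has_vector_derivative f' z) (at s)"
proof -
  have "((\<lambda>s. y + s *\<^sub>R z) has_derivative (\<lambda>k. k *\<^sub>R z)) (at s)"
    by (auto intro!: derivative_eq_intros)
  from diff_chain_at[OF this assms] show ?thesis
    unfolding has_vector_derivative_def o_def
    by (simp add: linear_cmul[OF has_derivative_linear[OF assms]])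
qed

text \<open>Both sides of the symmetry of the second derivative are limits of the same second difference,
  which is symmetric in \<open>u\<close> and \<open>v\<close>. Here it is written as a value of one of the two mixed
  derivatives near \<open>x\<close>, by the mean value theorem first along \<open>u\<close>, then along \<open>v\<close>. The scalar
  product with \<open>w\<close> is there because the mean value theorem holds for real-valued functions only.\<close>

lemma second_difference_mean_value:
  fixes f :: "'a::euclidean_space \<Rightarrow> 'b::euclidean_space"
  assumes h: "0 < (h::real)"
    and inS: "\<And>s t. \<lbrakk>0 \<le> s; s \<le> h; 0 \<le> t; t \<le> h\<rbrakk> \<Longrightarrow> x + s *\<^sub>R u + t *\<^sub>R v \<in> S"
    and f: "\<And>y. y \<in> S \<Longrightarrow> (f has_derivative f' y) (at y)"
    and f'u: "\<And>y. y \<in> S \<Longrightarrow> ((\<lambda>y. f' y u) has_derivative f'' y) (at y)"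
  shows "\<exists>s t. 0 < s \<and> s < h \<and> 0 < t \<and> t < h \<and>
    (f (x + h *\<^sub>R u + h *\<^sub>R v) - f (x + h *\<^sub>R u) - f (x + h *\<^sub>R v) + f x) \<bullet> w
    = h\<^sup>2 * (f'' (x + s *\<^sub>R u + t *\<^sub>R v) v \<bullet> w)"
proof -
  define \<phi> where "\<phi> s = (f (x + s *\<^sub>R u + h *\<^sub>R v) - f (x + s *\<^sub>R u)) \<bullet> w" for s
  have d\<phi>: "(\<phi> has_real_derivative (f' (x + s *\<^sub>R u + h *\<^sub>R v) u - f' (x + s *\<^sub>R u) u) \<bullet> w) (at s)"
    if s: "0 \<le> s" "s \<le> h" for s
  proof -
    have in1: "x + s *\<^sub>R u + h *\<^sub>R v \<in> S" and in2: "x + s *\<^sub>R u \<in> S"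
      using inS[OF s, of h] inS[OF s, of 0] h by auto
    have e: "x + s *\<^sub>R u + h *\<^sub>R v = (x + h *\<^sub>R v) + s *\<^sub>R u" for s by simp
    have "((\<lambda>s. f (x + s *\<^sub>R u + h *\<^sub>R v) - f (x + s *\<^sub>R u)) has_vector_derivative
        f' (x + s *\<^sub>R u + h *\<^sub>R v) u - f' (x + s *\<^sub>R u) u) (at s)"
      using in1 in2 unfolding e
      by (intro has_vector_derivative_diff has_vector_derivative_along_line f)
    from bounded_linear.has_vector_derivative[OF bounded_linear_inner_left this]
    show ?thesis
      unfolding has_real_derivative_iff_has_vector_derivative \<phi>_def .
  qed
  obtain s where s: "0 < s" "s < h"
    and s_eq: "\<phi> h - \<phi> 0 = h * ((f' (x + s *\<^sub>R u + h *\<^sub>R v) u - f' (x + s *\<^sub>R u) u) \<bullet> w)"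
    using MVT2[OF h d\<phi>] by auto
  define \<psi> where "\<psi> t = f' (x + s *\<^sub>R u + t *\<^sub>R v) u \<bullet> w" for t
  have d\<psi>: "(\<psi> has_real_derivative f'' (x + s *\<^sub>R u + t *\<^sub>R v) v \<bullet> w) (at t)"
    if t: "0 \<le> t" "t \<le> h" for t
  proof -
    have inn: "x + s *\<^sub>R u + t *\<^sub>R v \<in> S" using inS[OF _ _ t, of s] s by auto
    from bounded_linear.has_vector_derivative[OF bounded_linear_inner_left
        has_vector_derivative_along_line[OF f'u[OF inn]]]
    show ?thesis
      unfolding has_real_derivative_iff_has_vector_derivative \<psi>_def .
  qed
  obtain t where t: "0 < t" "t < h" and t_eq: "\<psi> h - \<psi> 0 = h * (f'' (x + s *\<^sub>R u + t *\<^sub>R v) v \<bullet> w)"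
    using MVT2[OF h d\<psi>] by auto
  have "\<phi> h - \<phi> 0 = h * (\<psi> h - \<psi> 0)"
    unfolding s_eq \<psi>_def by (simp add: inner_diff_left)
  also have "\<dots> = h\<^sup>2 * (f'' (x + s *\<^sub>R u + t *\<^sub>R v) v \<bullet> w)"
    unfolding t_eq by (simp add: power2_eq_square)
  finally have "\<phi> h - \<phi> 0 = h\<^sup>2 * (f'' (x + s *\<^sub>R u + t *\<^sub>R v) v \<bullet> w)" .
  moreover have "\<phi> h - \<phi> 0
    = (f (x + h *\<^sub>R u + h *\<^sub>R v) - f (x + h *\<^sub>R u) - f (x + h *\<^sub>R v) + f x) \<bullet> w"
    unfolding \<phi>_def by (simp add: algebra_simps inner_diff_left inner_add_left)
  ultimately show ?thesis using s t by metis
qed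

lemma smooth_on_second_derivative_symmetric:
  fixes f :: "'a::euclidean_space \<Rightarrow> 'b::euclidean_space"
  assumes f: "smooth_on S f" and S: "open S" and x: "x \<in> S"
  shows "frechet_derivative (\<lambda>y. frechet_derivative f (at y) u) (at x) v
       = frechet_derivative (\<lambda>y. frechet_derivative f (at y) v) (at x) u"
proof -
  define D where "D u v y = frechet_derivative (\<lambda>y. frechet_derivative f (at y) u) (at y) v" for u v y
  have f': "(f has_derivative frechet_derivative f (at y)) (at y)" if "y \<in> S" for y
    by (rule smooth_on_has_derivative[OF f S that])
  have f'': "((\<lambda>y. frechet_derivative f (at y) u) has_derivative (\<lambda>v. D u v y)) (at y)" if "y \<in> S" for u y
    unfolding D_def using smooth_on_has_derivative[OF smooth_on_derivative[OF f S] S that] by simp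
  have cont: "isCont (D u v) x" for u v
    unfolding D_def using smooth_on_imp_continuous_on[OF smooth_on_derivative[OF smooth_on_derivative[OF f S] S]] S x
    by (simp add: continuous_on_eq_continuous_at)
  obtain r where r: "r > 0" "ball x r \<subseteq> S" using S x by (meson openE)
  have close: "dist (D u v x \<bullet> w) (D v u x \<bullet> w) < e" if e: "e > 0" for e w
  proof -
    have "isCont (\<lambda>y. D u v y \<bullet> w) x" "isCont (\<lambda>y. D v u y \<bullet> w) x"
      using cont by (auto intro!: continuous_intros)
    then obtain d1 d2 where d: "d1 > 0" "d2 > 0"
      and d1: "\<And>y. dist y x < d1 \<Longrightarrow> dist (D u v y \<bullet> w) (D u v x \<bullet> w) < e / 2"
      and d2: "\<And>y. dist y x < d2 \<Longrightarrow> dist (D v u y \<bullet> w) (D v u x \<bullet> w) < e / 2"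
      using e unfolding continuous_at_eps_delta by (metis half_gt_zero_iff)
    define m where "m = min r (min d1 d2)"
    \<comment> \<open>With \<open>h = m / K\<close> the parallelogram spanned by \<open>h u\<close> and \<open>h v\<close> at \<open>x\<close> lies within distance \<open>m\<close>.\<close>
    define K where "K = 2 * (norm u + norm v + 1)"
    have K: "K > 0" "norm u + norm v < K" unfolding K_def by (simp_all add: algebra_simps add_nonneg_pos add_pos_nonneg)
    define h where "h = m / K"
    have m: "m > 0" using r d by (simp add: m_def)
    have h: "h > 0" using m K by (simp add: h_def)
    have near: "dist (x + s *\<^sub>R u + t *\<^sub>R v) x < m"
      if "0 \<le> s" "s \<le> h" "0 \<le> t" "t \<le> h" for s t
    proof -
      have "dist (x + s *\<^sub>R u + t *\<^sub>R v) x \<le> s * norm u + t * norm v"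
        using norm_triangle_ineq[of "s *\<^sub>R u" "t *\<^sub>R v"] that by (simp add: dist_norm)
      also have "\<dots> \<le> h * norm u + h * norm v"
        using that by (intro add_mono mult_right_mono) auto
      also have "\<dots> = h * (norm u + norm v)" by (simp add: distrib_left)
      also have "\<dots> < h * K" by (rule mult_strict_left_mono[OF K(2) h])
      also have "\<dots> = m" using K by (simp add: h_def)
      finally show ?thesis .
    qed
    have inS: "x + s *\<^sub>R u + t *\<^sub>R v \<in> S" if "0 \<le> s" "s \<le> h" "0 \<le> t" "t \<le> h" for s t
      using near[OF that] r by (auto simp: m_def dist_commute)
    obtain s1 t1 where 1: "0 < s1" "s1 < h" "0 < t1" "t1 < h"
      and eq1: "(f (x + h *\<^sub>R u + h *\<^sub>R v) - f (x + h *\<^sub>R u) - f (x + h *\<^sub>R v) + f x) \<bullet> w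
        = h\<^sup>2 * (D u v (x + s1 *\<^sub>R u + t1 *\<^sub>R v) \<bullet> w)"
      using second_difference_mean_value[OF h inS f' f'', where w = w] by blast
    have inS': "x + s *\<^sub>R v + t *\<^sub>R u \<in> S" if "0 \<le> s" "s \<le> h" "0 \<le> t" "t \<le> h" for s t
      using inS[OF that(3,4,1,2)] by (simp add: algebra_simps)
    obtain s2 t2 where 2: "0 < s2" "s2 < h" "0 < t2" "t2 < h"
      and eq2: "(f (x + h *\<^sub>R v + h *\<^sub>R u) - f (x + h *\<^sub>R v) - f (x + h *\<^sub>R u) + f x) \<bullet> w
        = h\<^sup>2 * (D v u (x + s2 *\<^sub>R v + t2 *\<^sub>R u) \<bullet> w)"
      using second_difference_mean_value[OF h inS' f' f'', where w = w] by blast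
    have "h\<^sup>2 * (D u v (x + s1 *\<^sub>R u + t1 *\<^sub>R v) \<bullet> w) = h\<^sup>2 * (D v u (x + t2 *\<^sub>R u + s2 *\<^sub>R v) \<bullet> w)"
      unfolding eq1[symmetric] using eq2 by (simp add: algebra_simps)
    then have eq: "D u v (x + s1 *\<^sub>R u + t1 *\<^sub>R v) \<bullet> w = D v u (x + t2 *\<^sub>R u + s2 *\<^sub>R v) \<bullet> w"
      using h by simp
    have "dist (D u v (x + s1 *\<^sub>R u + t1 *\<^sub>R v) \<bullet> w) (D u v x \<bullet> w) < e / 2"
      using 1 near[of s1 t1] by (intro d1) (auto simp: m_def)
    moreover have "dist (D v u (x + t2 *\<^sub>R u + s2 *\<^sub>R v) \<bullet> w) (D v u x \<bullet> w) < e / 2"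
      using 2 near[of t2 s2] by (intro d2) (auto simp: m_def)
    ultimately show ?thesis unfolding eq
      by (metis dist_commute dist_triangle_half_l)
  qed
  have "D u v x \<bullet> w = D v u x \<bullet> w" for w
    using close[of "dist (D u v x \<bullet> w) (D v u x \<bullet> w)" w] by (metis less_irrefl zero_less_dist_iff)
  then have "D u v x = D v u x"
    by (meson vector_eq_ldot vector_eq_rdot)
  then show ?thesis by (simp add: D_def)
qed

text \<open>The product rule for \<open>y \<mapsto> Df(y)(Y(y))\<close>. Smoothness gives the derivative of
  \<open>y \<mapsto> Df(y)(v)\<close> only for fixed \<open>v\<close>, so \<open>Y\<close> is expanded in a basis; the terms are summed up again
  by linearity of the second derivative in \<open>v\<close>, which follows from its symmetry.\<close>

lemma has_derivative_derivative_apply: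
  fixes f :: "'a::euclidean_space \<Rightarrow> 'b::euclidean_space"
  assumes f: "smooth_on S f" and S: "open S" and x: "x \<in> S"
    and Y: "(Y has_derivative Y') (at x)"
  shows "((\<lambda>y. frechet_derivative f (at y) (Y y)) has_derivative
      (\<lambda>h. frechet_derivative f (at x) (Y' h)
         + frechet_derivative (\<lambda>y. frechet_derivative f (at y) (Y x)) (at x) h)) (at x)"
proof -
  define D where "D v h = frechet_derivative (\<lambda>y. frechet_derivative f (at y) v) (at x) h" for v h
  have dD: "((\<lambda>y. frechet_derivative f (at y) v) has_derivative D v) (at x)" for v
    using smooth_on_has_derivative[OF smooth_on_derivative[OF f S] S x]
    unfolding D_def by simp
  have sym: "D v h = D h v" for v h
    unfolding D_def by (rule smooth_on_second_derivative_symmetric[OF f S x])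
  have lin: "linear (frechet_derivative f (at y))" if "y \<in> S" for y
    using smooth_on_has_derivative[OF f S that] by (rule has_derivative_linear)
  have linD: "linear (D v)" for v using dD by (rule has_derivative_linear)
  have expand: "(\<Sum>i\<in>Basis. (z \<bullet> i) *\<^sub>R l i) = l z" if "linear l" for l :: "'a \<Rightarrow> 'b" and z
    by (metis (no_types, lifting) euclidean_representation linear_cmul linear_sum sum.cong that)
  have "((\<lambda>y. \<Sum>i\<in>Basis. (Y y \<bullet> i) *\<^sub>R frechet_derivative f (at y) i) has_derivative
      (\<lambda>h. \<Sum>i\<in>Basis. (Y x \<bullet> i) *\<^sub>R D i h + (Y' h \<bullet> i) *\<^sub>R frechet_derivative f (at x) i)) (at x)"
    by (intro has_derivative_sum has_derivative_scaleR has_derivative_inner_left Y dD)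
  moreover have "(\<Sum>i\<in>Basis. (Y x \<bullet> i) *\<^sub>R D i h + (Y' h \<bullet> i) *\<^sub>R frechet_derivative f (at x) i)
      = frechet_derivative f (at x) (Y' h) + D (Y x) h" for h
    unfolding sum.distrib sym[of _ h] expand[OF linD] expand[OF lin[OF x]] by simp
  ultimately have "((\<lambda>y. \<Sum>i\<in>Basis. (Y y \<bullet> i) *\<^sub>R frechet_derivative f (at y) i) has_derivative
      (\<lambda>h. frechet_derivative f (at x) (Y' h) + D (Y x) h)) (at x)"
    by simp
  then have "((\<lambda>y. frechet_derivative f (at y) (Y y)) has_derivative
      (\<lambda>h. frechet_derivative f (at x) (Y' h) + D (Y x) h)) (at x)"
    by (rule has_derivative_transform_within_open[OF _ S x]) (simp add: expand lin)
  then show ?thesis unfolding D_def .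
qed

text \<open>Naturality of the bracket: if \<open>P\<close>, \<open>Q\<close> are \<open>f\<close>-related to \<open>X\<close>, \<open>Y\<close>, then \<open>[P, Q]\<close> is
  \<open>f\<close>-related to \<open>[X, Y]\<close>. Differentiating the relations gives two second-derivative terms
  \<open>D\<^sup>2 f(X, Y)\<close>, which cancel by symmetry.\<close>

lemma bracket_pushforward:
  fixes f :: "'a::euclidean_space \<Rightarrow> 'b::euclidean_space"
  assumes f: "smooth_on S f" and S: "open S" and x: "x \<in> S"
    and X: "(X has_derivative X') (at x)" and Y: "(Y has_derivative Y') (at x)"
    and P: "(P has_derivative P') (at (f x))" and Q: "(Q has_derivative Q') (at (f x))"
    and PX: "\<And>y. y \<in> S \<Longrightarrow> P (f y) = frechet_derivative f (at y) (X y)"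
    and QY: "\<And>y. y \<in> S \<Longrightarrow> Q (f y) = frechet_derivative f (at y) (Y y)"
  shows "Q' (P (f x)) - P' (Q (f x)) = frechet_derivative f (at x) (Y' (X x) - X' (Y x))"
proof -
  have df: "(f has_derivative frechet_derivative f (at x)) (at x)"
    by (rule smooth_on_has_derivative[OF f S x])
  have chain: "R' (frechet_derivative f (at x) h) = frechet_derivative f (at x) (Z' h)
         + frechet_derivative (\<lambda>y. frechet_derivative f (at y) (Z x)) (at x) h"
    if Z: "(Z has_derivative Z') (at x)" and R: "(R has_derivative R') (at (f x))"
      and RZ: "\<And>y. y \<in> S \<Longrightarrow> R (f y) = frechet_derivative f (at y) (Z y)" for Z Z' R R' h
  proof -
    have "((\<lambda>y. R (f y)) has_derivative (\<lambda>h. frechet_derivative f (at x) (Z' h)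
         + frechet_derivative (\<lambda>y. frechet_derivative f (at y) (Z x)) (at x) h)) (at x)"
      by (rule has_derivative_transform_within_open[OF has_derivative_derivative_apply[OF f S x Z] S x])
        (simp add: RZ)
    from has_derivative_unique[OF has_derivative_compose[OF df R] this] show ?thesis
      by (simp add: fun_eq_iff)
  qed
  have "Q' (P (f x)) = frechet_derivative f (at x) (Y' (X x))
         + frechet_derivative (\<lambda>y. frechet_derivative f (at y) (Y x)) (at x) (X x)"
    using chain[OF Y Q QY, of "X x"] PX[OF x] by simp
  moreover have "P' (Q (f x)) = frechet_derivative f (at x) (X' (Y x))
         + frechet_derivative (\<lambda>y. frechet_derivative f (at y) (X x)) (at x) (Y x)"
    using chain[OF X P PX, of "Y x"] QY[OF x] by simp
  ultimately show ?thesis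
    using smooth_on_second_derivative_symmetric[OF f S x, of "Y x" "X x"]
    by (simp add: linear_diff[OF has_derivative_linear[OF df]])
qed

lemma bilinear_form_expansion:
  fixes b :: "'a::euclidean_space \<Rightarrow> 'a \<Rightarrow> real"
  assumes "bilinear b"
  shows "b v w = (\<Sum>i\<in>Basis. \<Sum>j\<in>Basis. (v \<bullet> i) * (w \<bullet> j) * b i j)"
proof -
  have "b v w = b (\<Sum>i\<in>Basis. (v \<bullet> i) *\<^sub>R i) (\<Sum>j\<in>Basis. (w \<bullet> j) *\<^sub>R j)"
    by (simp add: euclidean_representation)
  also have "\<dots> = (\<Sum>(i, j)\<in>Basis \<times> Basis. b ((v \<bullet> i) *\<^sub>R i) ((w \<bullet> j) *\<^sub>R j))"
    by (rule bilinear_sum[OF assms])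
  also have "\<dots> = (\<Sum>i\<in>Basis. \<Sum>j\<in>Basis. b ((v \<bullet> i) *\<^sub>R i) ((w \<bullet> j) *\<^sub>R j))"
    by (simp add: sum.cartesian_product)
  finally show ?thesis
    by (simp add: bilinear_lmul[OF assms] bilinear_rmul[OF assms] mult_ac)
qed

text \<open>Convergence of a bilinear form on fixed vectors is enough, since in finite dimension the form
  is determined by its finitely many coefficients.\<close>

lemma tendsto_bilinear_form:
  fixes b :: "'x \<Rightarrow> 'a::euclidean_space \<Rightarrow> 'a \<Rightarrow> real"
  assumes bil: "eventually (\<lambda>x. bilinear (b x)) F" "bilinear c"
    and b: "\<And>i j. ((\<lambda>x. b x i j) \<longlongrightarrow> c i j) F"
    and v: "(v \<longlongrightarrow> v0) F" and w: "(w \<longlongrightarrow> w0) F"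
  shows "((\<lambda>x. b x (v x) (w x)) \<longlongrightarrow> c v0 w0) F"
proof (rule Lim_transform_eventually)
  show "((\<lambda>x. \<Sum>i\<in>Basis. \<Sum>j\<in>Basis. (v x \<bullet> i) * (w x \<bullet> j) * b x i j) \<longlongrightarrow> c v0 w0) F"
    unfolding bilinear_form_expansion[OF bil(2), of v0 w0]
    by (intro tendsto_sum tendsto_mult tendsto_inner v w b tendsto_const)
  show "\<forall>\<^sub>F x in F. (\<Sum>i\<in>Basis. \<Sum>j\<in>Basis. (v x \<bullet> i) * (w x \<bullet> j) * b x i j) = b x (v x) (w x)"
    using bil(1) by eventually_elim (simp add: bilinear_form_expansion)
qed

lemma difference_quotient_tendsto:
  assumes "(f has_vector_derivative d) (at 0)"
  shows "((\<lambda>t. (1 / t) *\<^sub>R (f t - f 0)) \<longlongrightarrow> d) (at 0)"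
proof (rule LIM_zero_cancel, rule tendsto_norm_zero_cancel, rule Lim_transform_eventually)
  show "((\<lambda>t. norm (f t - f 0 - t *\<^sub>R d) / norm t) \<longlongrightarrow> 0) (at 0)"
    using assms unfolding has_vector_derivative_def has_derivative_at by simp
  have "(1 / t) *\<^sub>R (f t - f 0) - d = (1 / t) *\<^sub>R (f t - f 0 - t *\<^sub>R d)" if "t \<noteq> 0" for t
    using that by (simp add: scaleR_diff_right)
  then show "\<forall>\<^sub>F t in at 0. norm (f t - f 0 - t *\<^sub>R d) / norm t = norm ((1 / t) *\<^sub>R (f t - f 0) - d)"
    by (simp add: eventually_at_filter)
qed

text \<open>Two frames \<open>L\<close> and \<open>R\<close> that agree at \<open>x\<close> and have the same Gram matrices near \<open>x\<close> differ
  to first order by a skew map. By bilinearity the equality of the Gram matrices says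
  \<open>b((L - R) v, L w) + b(R v, (L - R) w) = 0\<close>; dividing by \<open>t\<close> along \<open>x + t u\<close> and letting
  \<open>t \<rightarrow> 0\<close> gives the claim by continuity of \<open>b\<close> at \<open>x\<close>.\<close>

lemma skew_difference_of_isometric_frames:
  fixes b :: "'a::euclidean_space \<Rightarrow> 'a \<Rightarrow> 'a \<Rightarrow> real"
  assumes S: "open S" "x \<in> S"
    and bil: "\<And>y. y \<in> S \<Longrightarrow> bilinear (b y)"
    and cont: "\<And>v w. isCont (\<lambda>y. b y v w) x"
    and dL: "\<And>v. ((\<lambda>y. L y v) has_derivative L' v) (at x)"
    and dR: "\<And>v. ((\<lambda>y. R y v) has_derivative R' v) (at x)"
    and Lx: "\<And>v. L x v = v" and Rx: "\<And>v. R x v = v"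
    and eq: "\<And>y v w. y \<in> S \<Longrightarrow> b y (L y v) (L y w) = b y (R y v) (R y w)"
  shows "b x (L' v u - R' v u) w + b x v (L' w u - R' w u) = 0"
proof -
  define q where "q v t = (1 / t) *\<^sub>R (L (x + t *\<^sub>R u) v - R (x + t *\<^sub>R u) v)" for v and t :: real
  have lim: "((\<lambda>t. x + t *\<^sub>R u) \<longlongrightarrow> x) (at 0)"
    by (auto intro!: tendsto_eq_intros)
  have vanish: "\<forall>\<^sub>F t in at 0. x + t *\<^sub>R u \<in> S"
    by (rule topological_tendstoD[OF lim S])
  have qlim: "(q v \<longlongrightarrow> L' v u - R' v u) (at 0)" for v
  proof -
    have "((\<lambda>y. L y v - R y v) has_derivative (\<lambda>h. L' v h - R' v h)) (at x)"
      by (intro has_derivative_diff dL dR)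
    then have "((\<lambda>t. L (x + t *\<^sub>R u) v - R (x + t *\<^sub>R u) v) has_vector_derivative
        (L' v u - R' v u)) (at 0)"
      by (intro has_vector_derivative_along_line) simp
    from difference_quotient_tendsto[OF this] show ?thesis
      by (simp add: q_def[abs_def] Lx Rx)
  qed
  have bilx: "bilinear (b x)" using bil S by simp
  have contL: "((\<lambda>t. L (x + t *\<^sub>R u) v) \<longlongrightarrow> v) (at 0)" for v
  proof -
    have "isCont (\<lambda>y. L y v) x" by (rule has_derivative_continuous[OF dL])
    from isCont_tendsto_compose[OF this lim] show ?thesis by (simp add: Lx)
  qed
  have contR: "((\<lambda>t. R (x + t *\<^sub>R u) v) \<longlongrightarrow> v) (at 0)" for v
  proof -
    have "isCont (\<lambda>y. R y v) x" by (rule has_derivative_continuous[OF dR])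
    from isCont_tendsto_compose[OF this lim] show ?thesis by (simp add: Rx)
  qed
  have contb: "((\<lambda>t. b (x + t *\<^sub>R u) v w) \<longlongrightarrow> b x v w) (at 0)" for v w
    by (rule isCont_tendsto_compose[OF cont lim])
  have bile: "\<forall>\<^sub>F t in at 0. bilinear (b (x + t *\<^sub>R u))"
    using vanish by (rule eventually_mono) (rule bil)
  have "((\<lambda>t. b (x + t *\<^sub>R u) (q v t) (L (x + t *\<^sub>R u) w)) \<longlongrightarrow> b x (L' v u - R' v u) w) (at 0)"
    by (rule tendsto_bilinear_form[OF bile bilx contb qlim contL])
  moreover have "((\<lambda>t. b (x + t *\<^sub>R u) (R (x + t *\<^sub>R u) v) (q w t)) \<longlongrightarrow> b x v (L' w u - R' w u)) (at 0)"
    by (rule tendsto_bilinear_form[OF bile bilx contb contR qlim])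
  ultimately have "((\<lambda>t. b (x + t *\<^sub>R u) (q v t) (L (x + t *\<^sub>R u) w) + b (x + t *\<^sub>R u) (R (x + t *\<^sub>R u) v) (q w t))
      \<longlongrightarrow> b x (L' v u - R' v u) w + b x v (L' w u - R' w u)) (at 0)"
    by (rule tendsto_add)
  moreover have "\<forall>\<^sub>F t in at 0. b (x + t *\<^sub>R u) (q v t) (L (x + t *\<^sub>R u) w)
      + b (x + t *\<^sub>R u) (R (x + t *\<^sub>R u) v) (q w t) = 0"
    using vanish
  proof (rule eventually_mono)
    fix t assume inS: "x + t *\<^sub>R u \<in> S"
    note bl = bil[OF inS]
    have "b (x + t *\<^sub>R u) (q v t) (L (x + t *\<^sub>R u) w) + b (x + t *\<^sub>R u) (R (x + t *\<^sub>R u) v) (q w t)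
      = (1 / t) * (b (x + t *\<^sub>R u) (L (x + t *\<^sub>R u) v) (L (x + t *\<^sub>R u) w)
          - b (x + t *\<^sub>R u) (R (x + t *\<^sub>R u) v) (R (x + t *\<^sub>R u) w))"
      unfolding q_def bilinear_lmul[OF bl] bilinear_rmul[OF bl] bilinear_lsub[OF bl] bilinear_rsub[OF bl]
      by (simp add: algebra_simps)
    then show "b (x + t *\<^sub>R u) (q v t) (L (x + t *\<^sub>R u) w)
        + b (x + t *\<^sub>R u) (R (x + t *\<^sub>R u) v) (q w t) = 0"
      using eq[OF inS] by simp
  qed
  ultimately have "((\<lambda>t::real. 0::real) \<longlongrightarrow> b x (L' v u - R' v u) w + b x v (L' w u - R' w u)) (at 0)"
    by (rule Lim_transform_eventually)
  from tendsto_unique[OF _ this tendsto_const] show ?thesis by simp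
qed

section \<open>Maps of a manifold in charts\<close>

text \<open>Unlike \<^const>\<open>tangent_map\<close>, this takes the charts as arguments, so that the chain rule holds
  with an arbitrary intermediate chart. The map \<^const>\<open>id\<close> gives the change of charts.\<close>

definition chart_derivative ::
  "('g, 'e::euclidean_space) chart \<Rightarrow> ('g, 'e) chart \<Rightarrow> ('g \<Rightarrow> 'g) \<Rightarrow> 'g \<Rightarrow> 'e \<Rightarrow> 'e" where
  "chart_derivative c d f p = frechet_derivative (snd d \<circ> f \<circ> chart_inv c) (at (snd c p))"

locale atlas_manifold =
  fixes A :: "('g::topological_space, 'e::euclidean_space) chart set"
  assumes atlas: "smooth_atlas A"
begin

lemma chart_homeomorphism:
  "c \<in> A \<Longrightarrow> homeomorphism (fst c) (snd c ` fst c) (snd c) (chart_inv c)"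
  using atlas by (simp add: smooth_atlas_def)

lemma open_chart_domain: "c \<in> A \<Longrightarrow> open (fst c)"
  using atlas by (simp add: smooth_atlas_def)

lemma chart_inv_chart [simp]: "c \<in> A \<Longrightarrow> p \<in> fst c \<Longrightarrow> chart_inv c (snd c p) = p"
  by (rule homeomorphism_apply1[OF chart_homeomorphism])

lemma open_chart_image:
  assumes c: "c \<in> A" and U: "open U" "U \<subseteq> fst c"
  shows "open (snd c ` U)"
proof -
  have "openin (top_of_set (fst c)) U" using U by (simp add: openin_open_eq open_chart_domain[OF c])
  then have "openin (top_of_set (snd c ` fst c)) (snd c ` U)"
    by (rule homeomorphism_imp_open_map[OF chart_homeomorphism[OF c]])
  moreover have "open (snd c ` fst c)" using atlas c by (simp add: smooth_atlas_def)
  ultimately show ?thesis by (rule openin_open_trans)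
qed

lemma chart_at: "chart_at A p \<in> A" "p \<in> fst (chart_at A p)"
proof -
  have "p \<in> (\<Union>c\<in>A. fst c)" using atlas by (simp add: smooth_atlas_def)
  then have "\<exists>c. c \<in> A \<and> p \<in> fst c" by blast
  then have "chart_at A p \<in> A \<and> p \<in> fst (chart_at A p)"
    unfolding chart_at_def by (rule someI_ex)
  then show "chart_at A p \<in> A" "p \<in> fst (chart_at A p)" by simp_all
qed

lemma open_overlap:
  assumes f: "smooth_map A A f" and c: "c \<in> A" and d: "d \<in> A"
  shows "open (snd c ` (fst c \<inter> f -` fst d))"
proof (rule open_chart_image[OF c])
  have "open (f -` fst d)"
    using f open_chart_domain[OF d] by (simp add: smooth_map_def open_vimage)
  then show "open (fst c \<inter> f -` fst d)" using open_chart_domain[OF c] by blast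
qed simp

lemma smooth_in_charts:
  assumes "smooth_map A A f" "c \<in> A" "d \<in> A"
  shows "smooth_on (snd c ` (fst c \<inter> f -` fst d)) (snd d \<circ> f \<circ> chart_inv c)"
  using assms by (simp add: smooth_map_def)

lemma has_derivative_in_charts:
  assumes "smooth_map A A f" "c \<in> A" "d \<in> A" "p \<in> fst c" "f p \<in> fst d"
  shows "(snd d \<circ> f \<circ> chart_inv c has_derivative chart_derivative c d f p) (at (snd c p))"
  unfolding chart_derivative_def
  by (rule smooth_on_has_derivative[OF smooth_in_charts open_overlap])
    (use assms in auto)

lemma linear_chart_derivative:
  assumes "smooth_map A A f" "c \<in> A" "d \<in> A" "p \<in> fst c" "f p \<in> fst d"
  shows "linear (chart_derivative c d f p)"
  using has_derivative_in_charts[OF assms] by (rule has_derivative_linear)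

text \<open>The composite is passed as a separate function \<open>m\<close>, so that a product of translations can be
  inserted in the form in which it occurs.\<close>

lemma chart_derivative_chain:
  assumes f: "smooth_map A A f" and h: "smooth_map A A h"
    and c: "c \<in> A" and d: "d \<in> A" and k: "k \<in> A"
    and p: "p \<in> fst c" "h p \<in> fst d" "f (h p) \<in> fst k"
    and m: "\<And>q. m q = f (h q)"
  shows "chart_derivative c k m p v = chart_derivative d k f (h p) (chart_derivative c d h p v)"
proof -
  have val: "(snd d \<circ> h \<circ> chart_inv c) (snd c p) = snd d (h p)"
    using c p by simp
  have "(snd k \<circ> f \<circ> chart_inv d \<circ> (snd d \<circ> h \<circ> chart_inv c) has_derivative
      chart_derivative d k f (h p) \<circ> chart_derivative c d h p) (at (snd c p))"
    using has_derivative_in_charts[OF f d k p(2,3)]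
    by (intro diff_chain_at has_derivative_in_charts[OF h c d p(1,2)]) (simp only: val)
  then have "(snd k \<circ> m \<circ> chart_inv c has_derivative
      chart_derivative d k f (h p) \<circ> chart_derivative c d h p) (at (snd c p))"
    by (rule has_derivative_transform_within_open[OF _ open_overlap[OF h c d]])
      (use c d p in \<open>auto simp: m\<close>)
  from frechet_derivative_at[OF this] show ?thesis
    unfolding chart_derivative_def[of c k] by (simp add: fun_eq_iff)
qed

lemma smooth_map_id: "smooth_map A A id"
proof -
  have "snd c ` (fst c \<inter> id -` fst d) = snd c ` (fst c \<inter> fst d)" for c d :: "('g, 'e) chart"
    by simp
  then show ?thesis
    using atlas by (simp add: smooth_map_def smooth_atlas_def)
qed

lemma chart_derivative_id:
  assumes c: "c \<in> A" and p: "p \<in> fst c"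
  shows "chart_derivative c c id p v = v"
proof -
  have "((\<lambda>x. x) has_derivative (\<lambda>v. v)) (at (snd c p))" by simp
  then have "(snd c \<circ> id \<circ> chart_inv c has_derivative (\<lambda>v. v)) (at (snd c p))"
    by (rule has_derivative_transform_within_open[OF _ open_chart_image[OF c open_chart_domain[OF c]]])
      (use c p in auto)
  from frechet_derivative_at[OF this] show ?thesis
    unfolding chart_derivative_def by (rule fun_cong[OF sym])
qed

lemma field_in_chart_eq:
  assumes "c \<in> A" "p \<in> fst c"
  shows "field_in_chart A c X (snd c p) = chart_derivative (chart_at A p) c id p (X p)"
  using assms by (simp add: field_in_chart_def chart_derivative_def Let_def)

end

section \<open>Left-invariant fields\<close>

lemma chart_inv_prod:
  assumes "inj_on (snd c) (fst c)" "inj_on (snd d) (fst d)" "p \<in> fst c" "q \<in> fst d"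
  shows "chart_inv (fst c \<times> fst d, map_prod (snd c) (snd d)) (snd c p, snd d q) = (p, q)"
proof -
  have "inj_on (map_prod (snd c) (snd d)) (fst c \<times> fst d)"
    using assms by (auto simp: inj_on_def)
  from inv_into_f_f[OF this, of "(p, q)"] show ?thesis
    using assms by (simp add: chart_inv_def)
qed

locale charted_lie_group =
  fixes G :: "('g::{t2_space, second_countable_topology}, 'e::euclidean_space) lie_group_data"
  assumes lie_group: "lie_group G"
begin

sublocale group G
  using lie_group by (simp add: lie_group_def)

sublocale atlas_manifold "atlas G"
  by unfold_locales (use lie_group in \<open>simp add: lie_group_def\<close>)

lemma carrier_UNIV [simp]: "x \<in> carrier G"
  using lie_group by (simp add: lie_group_def)

text \<open>The chart in which \<^const>\<open>chart_at\<close> expresses tangent vectors at the identity, that is, elements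
  of the Lie algebra.\<close>

definition unit_chart where "unit_chart = chart_at (atlas G) \<one>\<^bsub>G\<^esub>"

lemma unit_chart: "unit_chart \<in> atlas G" "\<one>\<^bsub>G\<^esub> \<in> fst unit_chart"
  unfolding unit_chart_def by (rule chart_at)+

text \<open>The multiplication is kept as a function on pairs of coordinates, because the tangent maps of
  left and right translations are its partial derivatives, and the bracket is the antisymmetrised
  mixed derivative.\<close>

definition mult_in_charts where
  "mult_in_charts c d k z = snd k (chart_inv c (fst z) \<otimes>\<^bsub>G\<^esub> chart_inv d (snd z))"

definition mult_domain where
  "mult_domain c d k = {(snd c p, snd d q) | p q. p \<in> fst c \<and> q \<in> fst d \<and> p \<otimes>\<^bsub>G\<^esub> q \<in> fst k}"

lemma continuous_mult: "continuous_on UNIV (\<lambda>(x, y). x \<otimes>\<^bsub>G\<^esub> y)"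
  using lie_group by (simp add: lie_group_def smooth_map_def)

lemma open_mult_domain:
  assumes "c \<in> atlas G" "d \<in> atlas G" "k \<in> atlas G"
  shows "open (mult_domain c d k)"
proof (subst open_subopen, rule ballI)
  fix z assume "z \<in> mult_domain c d k"
  then obtain p q where z: "z = (snd c p, snd d q)" and p: "p \<in> fst c" "q \<in> fst d"
    and pq: "p \<otimes>\<^bsub>G\<^esub> q \<in> fst k" by (auto simp: mult_domain_def)
  have "open ((\<lambda>(x, y). x \<otimes>\<^bsub>G\<^esub> y) -` fst k)"
    using continuous_mult open_chart_domain[OF assms(3)] by (rule open_vimage[rotated])
  moreover have "(p, q) \<in> (\<lambda>(x, y). x \<otimes>\<^bsub>G\<^esub> y) -` fst k" using pq by simp
  ultimately obtain U V where U: "open U" "open V" "(p, q) \<in> U \<times> V"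
    and sub: "U \<times> V \<subseteq> (\<lambda>(x, y). x \<otimes>\<^bsub>G\<^esub> y) -` fst k" by (rule open_prod_elim)
  define W where "W = (snd c ` (U \<inter> fst c)) \<times> (snd d ` (V \<inter> fst d))"
  have "open W"
    unfolding W_def using U open_chart_domain[OF assms(1)] open_chart_domain[OF assms(2)]
    by (intro open_Times open_chart_image assms open_Int) auto
  moreover have "z \<in> W" using z p U by (auto simp: W_def)
  moreover have "W \<subseteq> mult_domain c d k"
  proof
    fix y assume "y \<in> W"
    then obtain a b where ab: "y = (snd c a, snd d b)" "a \<in> U" "a \<in> fst c" "b \<in> V" "b \<in> fst d"
      unfolding W_def by blast
    then have "(a, b) \<in> U \<times> V" by simp
    then have "a \<otimes>\<^bsub>G\<^esub> b \<in> fst k" using sub by fastforce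
    then show "y \<in> mult_domain c d k" unfolding mult_domain_def using ab by blast
  qed
  ultimately show "\<exists>T. open T \<and> z \<in> T \<and> T \<subseteq> mult_domain c d k" by blast
qed

lemma smooth_mult_in_charts:
  assumes c: "c \<in> atlas G" and d: "d \<in> atlas G" and k: "k \<in> atlas G"
  shows "smooth_on (mult_domain c d k) (mult_in_charts c d k)"
proof -
  let ?m = "\<lambda>(x, y). x \<otimes>\<^bsub>G\<^esub> y" and ?cd = "(fst c \<times> fst d, map_prod (snd c) (snd d))"
  have inj: "inj_on (snd c) (fst c)" "inj_on (snd d) (fst d)"
    using chart_inv_chart[OF c] chart_inv_chart[OF d] by (auto intro: inj_on_inverseI)
  have "?cd \<in> prod_atlas (atlas G) (atlas G)"
    unfolding prod_atlas_def using c d by blast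
  moreover have "smooth_map (prod_atlas (atlas G) (atlas G)) (atlas G) ?m"
    using lie_group by (simp add: lie_group_def)
  ultimately have "smooth_on (snd ?cd ` (fst ?cd \<inter> ?m -` fst k)) (snd k \<circ> ?m \<circ> chart_inv ?cd)"
    using k unfolding smooth_map_def by blast
  moreover have "snd ?cd ` (fst ?cd \<inter> ?m -` fst k) = mult_domain c d k"
    unfolding mult_domain_def by force
  moreover have cong: "(snd k \<circ> ?m \<circ> chart_inv ?cd) z = mult_in_charts c d k z"
    if "z \<in> mult_domain c d k" for z
    using that c d chart_inv_prod[OF inj] by (auto simp: mult_domain_def mult_in_charts_def)
  ultimately show ?thesis by (simp only: smooth_on_cong[OF cong])
qed

lemma continuous_left_translation: "continuous_on UNIV (\<lambda>x. a \<otimes>\<^bsub>G\<^esub> x)"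
  using continuous_on_compose2[OF continuous_mult, of UNIV "\<lambda>x. (a, x)"]
  by (simp add: continuous_on_Pair continuous_on_const continuous_on_id)

lemma continuous_right_translation: "continuous_on UNIV (\<lambda>x. x \<otimes>\<^bsub>G\<^esub> a)"
  using continuous_on_compose2[OF continuous_mult, of UNIV "\<lambda>x. (x, a)"]
  by (simp add: continuous_on_Pair continuous_on_const continuous_on_id)

lemma left_translation_in_charts:
  assumes "b \<in> atlas G" "a \<in> fst b"
  shows "snd d \<circ> (\<lambda>x. a \<otimes>\<^bsub>G\<^esub> x) \<circ> chart_inv c = (\<lambda>y. mult_in_charts b c d (snd b a, y))"
  using assms by (auto simp: mult_in_charts_def)

lemma right_translation_in_charts:
  assumes "b \<in> atlas G" "a \<in> fst b"
  shows "snd d \<circ> (\<lambda>x. x \<otimes>\<^bsub>G\<^esub> a) \<circ> chart_inv c = (\<lambda>y. mult_in_charts c b d (y, snd b a))"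
  using assms by (auto simp: mult_in_charts_def)

lemma smooth_left_translation: "smooth_map (atlas G) (atlas G) (\<lambda>x. a \<otimes>\<^bsub>G\<^esub> x)"
  unfolding smooth_map_def
proof (intro conjI ballI continuous_left_translation)
  fix c d assume c: "c \<in> atlas G" and d: "d \<in> atlas G"
  note b = chart_at[of a]
  show "smooth_on (snd c ` (fst c \<inter> (\<lambda>x. a \<otimes>\<^bsub>G\<^esub> x) -` fst d)) (snd d \<circ> (\<lambda>x. a \<otimes>\<^bsub>G\<^esub> x) \<circ> chart_inv c)"
    unfolding left_translation_in_charts[OF b]
    by (rule smooth_on_slice_snd[OF smooth_mult_in_charts[OF b(1) c d]])
      (use b in \<open>auto simp: mult_domain_def\<close>)
qed

lemma smooth_right_translation: "smooth_map (atlas G) (atlas G) (\<lambda>x. x \<otimes>\<^bsub>G\<^esub> a)"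
  unfolding smooth_map_def
proof (intro conjI ballI continuous_right_translation)
  fix c d assume c: "c \<in> atlas G" and d: "d \<in> atlas G"
  note b = chart_at[of a]
  show "smooth_on (snd c ` (fst c \<inter> (\<lambda>x. x \<otimes>\<^bsub>G\<^esub> a) -` fst d)) (snd d \<circ> (\<lambda>x. x \<otimes>\<^bsub>G\<^esub> a) \<circ> chart_inv c)"
    unfolding right_translation_in_charts[OF b]
    by (rule smooth_on_slice_fst[OF smooth_mult_in_charts[OF c b(1) d]])
      (use b in \<open>auto simp: mult_domain_def\<close>)
qed

lemma left_invariant_field_eq:
  "left_invariant_field G v p = chart_derivative unit_chart (chart_at (atlas G) p) (\<lambda>x. p \<otimes>\<^bsub>G\<^esub> x) \<one>\<^bsub>G\<^esub> v"
  by (simp add: left_invariant_field_def tangent_map_def chart_derivative_def unit_chart_def)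

lemma left_invariant_field_in_chart:
  assumes c: "c \<in> atlas G" "p \<in> fst c"
  shows "field_in_chart (atlas G) c (left_invariant_field G v) (snd c p)
    = chart_derivative unit_chart c (\<lambda>x. p \<otimes>\<^bsub>G\<^esub> x) \<one>\<^bsub>G\<^esub> v"
  unfolding field_in_chart_eq[OF c] left_invariant_field_eq
  using chart_derivative_chain[OF smooth_map_id smooth_left_translation[of p]
      unit_chart(1) chart_at(1) c(1) unit_chart(2),
      of p "\<lambda>x. p \<otimes>\<^bsub>G\<^esub> x" v] c chart_at(2)[of p]
  by simp

lemma left_translation_derivative:
  assumes c: "c \<in> atlas G" "p \<in> fst c"
  shows "chart_derivative unit_chart c (\<lambda>x. p \<otimes>\<^bsub>G\<^esub> x) \<one>\<^bsub>G\<^esub> v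
    = frechet_derivative (mult_in_charts c unit_chart c) (at (snd c p, snd unit_chart \<one>\<^bsub>G\<^esub>)) (0, v)"
proof -
  have "(snd c p, snd unit_chart \<one>\<^bsub>G\<^esub>) \<in> mult_domain c unit_chart c"
    unfolding mult_domain_def using c unit_chart by force
  from smooth_on_has_derivative[OF smooth_mult_in_charts open_mult_domain this] c unit_chart
  have D: "(mult_in_charts c unit_chart c has_derivative
      frechet_derivative (mult_in_charts c unit_chart c) (at (snd c p, snd unit_chart \<one>\<^bsub>G\<^esub>)))
      (at (snd c p, snd unit_chart \<one>\<^bsub>G\<^esub>))"
    by blast
  have "((\<lambda>y. (snd c p, y)) has_derivative (\<lambda>v. (0, v))) (at (snd unit_chart \<one>\<^bsub>G\<^esub>))"
    by (auto intro!: derivative_eq_intros)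
  from frechet_derivative_at[OF has_derivative_compose[OF this D]]
  show ?thesis
    unfolding chart_derivative_def left_translation_in_charts[OF c] by (rule fun_cong[OF sym])
qed

lemma right_translation_derivative:
  assumes c: "c \<in> atlas G" "p \<in> fst c"
  shows "chart_derivative unit_chart c (\<lambda>x. x \<otimes>\<^bsub>G\<^esub> p) \<one>\<^bsub>G\<^esub> v
    = frechet_derivative (mult_in_charts unit_chart c c) (at (snd unit_chart \<one>\<^bsub>G\<^esub>, snd c p)) (v, 0)"
proof -
  have "(snd unit_chart \<one>\<^bsub>G\<^esub>, snd c p) \<in> mult_domain unit_chart c c"
    unfolding mult_domain_def using c unit_chart by force
  from smooth_on_has_derivative[OF smooth_mult_in_charts open_mult_domain this] c unit_chart
  have D: "(mult_in_charts unit_chart c c has_derivative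
      frechet_derivative (mult_in_charts unit_chart c c) (at (snd unit_chart \<one>\<^bsub>G\<^esub>, snd c p)))
      (at (snd unit_chart \<one>\<^bsub>G\<^esub>, snd c p))"
    by blast
  have "((\<lambda>y. (y, snd c p)) has_derivative (\<lambda>v. (v, 0))) (at (snd unit_chart \<one>\<^bsub>G\<^esub>))"
    by (auto intro!: derivative_eq_intros)
  from frechet_derivative_at[OF has_derivative_compose[OF this D]]
  show ?thesis
    unfolding chart_derivative_def right_translation_in_charts[OF c] by (rule fun_cong[OF sym])
qed

text \<open>In a chart, a left-invariant field is a partial derivative of the smooth multiplication,
  restricted to the slice where the second factor is the identity.\<close>

lemma smooth_left_invariant_field: "smooth_field (atlas G) (left_invariant_field G v)"
  unfolding smooth_field_def
proof
  fix c assume c: "c \<in> atlas G"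
  have "smooth_on (snd c ` fst c)
    (\<lambda>x. frechet_derivative (mult_in_charts c unit_chart c) (at (x, snd unit_chart \<one>\<^bsub>G\<^esub>)) (0, v))"
    by (rule smooth_on_slice_fst[OF smooth_on_derivative[OF smooth_mult_in_charts open_mult_domain]])
      (use c unit_chart in \<open>force simp: mult_domain_def\<close>)+
  moreover have cong: "field_in_chart (atlas G) c (left_invariant_field G v) x
    = frechet_derivative (mult_in_charts c unit_chart c) (at (x, snd unit_chart \<one>\<^bsub>G\<^esub>)) (0, v)"
    if "x \<in> snd c ` fst c" for x
    using that by (auto simp: left_invariant_field_in_chart left_translation_derivative c)
  ultimately show "smooth_on (snd c ` fst c) (field_in_chart (atlas G) c (left_invariant_field G v))"
    by (simp only: smooth_on_cong[OF cong])
qed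

lemma left_invariant_field_has_derivative:
  assumes c: "c \<in> atlas G" "p \<in> fst c"
  shows "(field_in_chart (atlas G) c (left_invariant_field G v) has_derivative
    frechet_derivative (field_in_chart (atlas G) c (left_invariant_field G v)) (at (snd c p))) (at (snd c p))"
  by (rule smooth_on_has_derivative[where S = "snd c ` fst c"])
    (use c smooth_left_invariant_field in \<open>auto simp: smooth_field_def intro!: open_chart_image open_chart_domain\<close>)

lemma left_invariant_field_one: "left_invariant_field G v \<one>\<^bsub>G\<^esub> = v"
  using chart_derivative_id[OF unit_chart, of v]
  by (simp add: left_invariant_field_eq unit_chart_def[symmetric] id_def)

text \<open>The left-invariant fields are related to themselves by \<open>L\<^sub>p\<close>, because
  \<open>L\<^bsub>pq\<^esub> = L\<^sub>p \<circ> L\<^sub>q\<close>. Naturality of the bracket carries the bracket at the identity to \<open>p\<close>.\<close>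

lemma lie_bracket_left_invariant:
  "lie_bracket (atlas G) (left_invariant_field G u) (left_invariant_field G v) p
    = left_invariant_field G (algebra_bracket G u v) p"
proof -
  define c where "c = chart_at (atlas G) p"
  have c: "c \<in> atlas G" "p \<in> fst c" unfolding c_def by (rule chart_at)+
  define S where "S = snd unit_chart ` (fst unit_chart \<inter> (\<lambda>x. p \<otimes>\<^bsub>G\<^esub> x) -` fst c)"
  define \<phi> where "\<phi> = snd c \<circ> (\<lambda>x. p \<otimes>\<^bsub>G\<^esub> x) \<circ> chart_inv unit_chart"
  have S: "open S" unfolding S_def by (rule open_overlap[OF smooth_left_translation unit_chart(1) c(1)])
  have \<phi>: "smooth_on S \<phi>"
    unfolding S_def \<phi>_def by (rule smooth_in_charts[OF smooth_left_translation unit_chart(1) c(1)])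
  have one: "snd unit_chart \<one>\<^bsub>G\<^esub> \<in> S" unfolding S_def using unit_chart c by auto
  have \<phi>1: "\<phi> (snd unit_chart \<one>\<^bsub>G\<^esub>) = snd c p" unfolding \<phi>_def using unit_chart by simp
  have inv: "field_in_chart (atlas G) c (left_invariant_field G w) (\<phi> y)
      = frechet_derivative \<phi> (at y) (field_in_chart (atlas G) unit_chart (left_invariant_field G w) y)"
    if y: "y \<in> S" for w y
  proof -
    obtain q where q: "q \<in> fst unit_chart" "p \<otimes>\<^bsub>G\<^esub> q \<in> fst c" "y = snd unit_chart q"
      using y unfolding S_def by blast
    have "field_in_chart (atlas G) c (left_invariant_field G w) (\<phi> y)
        = chart_derivative unit_chart c (\<lambda>x. p \<otimes>\<^bsub>G\<^esub> q \<otimes>\<^bsub>G\<^esub> x) \<one>\<^bsub>G\<^esub> w"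
      using left_invariant_field_in_chart[OF c(1) q(2)] q unit_chart by (simp add: \<phi>_def)
    also have "\<dots> = chart_derivative unit_chart c (\<lambda>x. p \<otimes>\<^bsub>G\<^esub> x) q
        (chart_derivative unit_chart unit_chart (\<lambda>x. q \<otimes>\<^bsub>G\<^esub> x) \<one>\<^bsub>G\<^esub> w)"
      using chart_derivative_chain[OF smooth_left_translation[of p] smooth_left_translation[of q]
          unit_chart(1) unit_chart(1) c(1) unit_chart(2), of "\<lambda>x. p \<otimes>\<^bsub>G\<^esub> q \<otimes>\<^bsub>G\<^esub> x" w] q
      by (simp add: m_assoc)
    also have "\<dots> = frechet_derivative \<phi> (at y) (field_in_chart (atlas G) unit_chart (left_invariant_field G w) y)"
      unfolding q(3) left_invariant_field_in_chart[OF unit_chart(1) q(1)] by (simp add: chart_derivative_def \<phi>_def)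
    finally show ?thesis .
  qed
  let ?X = "\<lambda>w. field_in_chart (atlas G) unit_chart (left_invariant_field G w)"
    and ?P = "\<lambda>w. field_in_chart (atlas G) c (left_invariant_field G w)"
  have X1: "?X w (snd unit_chart \<one>\<^bsub>G\<^esub>) = w" for w
    using chart_derivative_id[OF unit_chart, of w] by (simp add: left_invariant_field_in_chart[OF unit_chart] id_def)
  have Pp: "?P w (snd c p) = left_invariant_field G w p" for w
    unfolding left_invariant_field_in_chart[OF c] by (simp add: left_invariant_field_eq c_def)
  note d = left_invariant_field_has_derivative
  from bracket_pushforward[OF \<phi> S one d[OF unit_chart] d[OF unit_chart]
      d[OF c, folded \<phi>1] d[OF c, folded \<phi>1] inv inv, of v u]
  have "lie_bracket (atlas G) (left_invariant_field G u) (left_invariant_field G v) p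
    = frechet_derivative \<phi> (at (snd unit_chart \<one>\<^bsub>G\<^esub>)) (algebra_bracket G u v)"
    unfolding \<phi>1 X1 Pp by
      (simp add: algebra_bracket_def lie_bracket_def c_def[symmetric] unit_chart_def[symmetric] left_invariant_field_one Let_def)
  then show ?thesis
    by (simp add: left_invariant_field_eq c_def[symmetric] chart_derivative_def \<phi>_def)
qed

lemma to_algebra_left_invariant_field: "to_algebra G p (left_invariant_field G v p) = v"
proof -
  let ?c = "chart_at (atlas G) p"
  have "to_algebra G p (left_invariant_field G v p)
    = chart_derivative ?c unit_chart (\<lambda>x. inv\<^bsub>G\<^esub> p \<otimes>\<^bsub>G\<^esub> x) p
        (chart_derivative unit_chart ?c (\<lambda>x. p \<otimes>\<^bsub>G\<^esub> x) \<one>\<^bsub>G\<^esub> v)"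
    by (simp add: left_invariant_field_eq to_algebra_def tangent_map_def chart_derivative_def unit_chart_def)
  also have "\<dots> = chart_derivative unit_chart unit_chart id \<one>\<^bsub>G\<^esub> v"
    using chart_derivative_chain[OF smooth_left_translation[of "inv\<^bsub>G\<^esub> p"] smooth_left_translation[of p]
        unit_chart(1) chart_at(1) unit_chart(1) unit_chart(2), of p id v] unit_chart(2) chart_at(2)[of p]
    by (simp add: m_assoc[symmetric])
  also have "\<dots> = v" by (rule chart_derivative_id[OF unit_chart])
  finally show ?thesis .
qed

end

section \<open>Bi-invariant metrics\<close>

locale bi_invariant_lie_group = charted_lie_group G
  for G :: "('g::{t2_space, second_countable_topology}, 'e::euclidean_space) lie_group_data" +
  fixes g :: "'g \<Rightarrow> 'e \<Rightarrow> 'e \<Rightarrow> real"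
  assumes bi_invariant: "bi_invariant_metric G g"
begin

lemma riemannian: "riemannian_metric (atlas G) g"
  using bi_invariant by (simp add: bi_invariant_metric_def)

lemma metric_bilinear: "bilinear (g p)"
  using riemannian by (simp add: riemannian_metric_def)

lemma metric_commute: "g p v w = g p w v"
  using riemannian by (simp add: riemannian_metric_def)

lemma metric_pos: "v \<noteq> 0 \<Longrightarrow> g p v v > 0"
  using riemannian by (simp add: riemannian_metric_def)

lemmas metric_linear = bilinear_ladd[OF metric_bilinear] bilinear_radd[OF metric_bilinear]
  bilinear_lmul[OF metric_bilinear] bilinear_rmul[OF metric_bilinear]
  bilinear_lneg[OF metric_bilinear] bilinear_rneg[OF metric_bilinear]
  bilinear_lsub[OF metric_bilinear] bilinear_rsub[OF metric_bilinear]

lemma left_invariant: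
  "g (a \<otimes>\<^bsub>G\<^esub> p) (tangent_map (atlas G) (atlas G) (\<lambda>x. a \<otimes>\<^bsub>G\<^esub> x) p v)
     (tangent_map (atlas G) (atlas G) (\<lambda>x. a \<otimes>\<^bsub>G\<^esub> x) p w) = g p v w"
  using bi_invariant by (simp add: bi_invariant_metric_def Let_def)

lemma right_invariant:
  "g (p \<otimes>\<^bsub>G\<^esub> a) (tangent_map (atlas G) (atlas G) (\<lambda>x. x \<otimes>\<^bsub>G\<^esub> a) p v)
     (tangent_map (atlas G) (atlas G) (\<lambda>x. x \<otimes>\<^bsub>G\<^esub> a) p w) = g p v w"
  using bi_invariant by (simp add: bi_invariant_metric_def Let_def)

lemma metric_left_invariant_field:
  "g p (left_invariant_field G v p) (left_invariant_field G w p) = g \<one>\<^bsub>G\<^esub> v w"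
  using left_invariant[of p "\<one>\<^bsub>G\<^esub>" v w] by (simp add: left_invariant_field_def)

text \<open>Left translation by the inverse of \<open>p\<close> is an isometry and undoes the left-invariant
  extension of \<open>w\<close>.\<close>

lemma metric_to_algebra: "g \<one>\<^bsub>G\<^esub> (to_algebra G p v) w = g p v (left_invariant_field G w p)"
  using left_invariant[of "inv\<^bsub>G\<^esub> p" p v "left_invariant_field G w p"]
    to_algebra_left_invariant_field[of p w]
  by (simp add: to_algebra_def)

text \<open>The metric in \<^term>\<open>unit_chart\<close>, in exactly the form whose smoothness is part of
  \<^const>\<open>riemannian_metric\<close>.\<close>

definition metric_in_chart where
  "metric_in_chart x v w = (let p = chart_inv unit_chart x;
      D = frechet_derivative (snd (chart_at (atlas G) p) \<circ> chart_inv unit_chart) (at x)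
    in g p (D v) (D w))"

lemma metric_in_chart_eq:
  assumes "p \<in> fst unit_chart"
  shows "metric_in_chart (snd unit_chart p) v w
    = g p (chart_derivative unit_chart (chart_at (atlas G) p) id p v)
        (chart_derivative unit_chart (chart_at (atlas G) p) id p w)"
  using assms unit_chart by (simp add: metric_in_chart_def chart_derivative_def Let_def)

lemma bilinear_metric_in_chart:
  assumes p: "p \<in> fst unit_chart"
  shows "bilinear (metric_in_chart (snd unit_chart p))"
proof -
  have "linear (chart_derivative unit_chart (chart_at (atlas G) p) id p)"
    by (rule linear_chart_derivative[OF smooth_map_id unit_chart(1) chart_at(1) p]) (simp add: chart_at)
  then show ?thesis
    unfolding bilinear_def metric_in_chart_eq[OF p]
    by (auto intro!: linearI simp: linear_add linear_cmul metric_linear)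
qed

lemma metric_in_chart_one: "metric_in_chart (snd unit_chart \<one>\<^bsub>G\<^esub>) v w = g \<one>\<^bsub>G\<^esub> v w"
  using chart_derivative_id[OF unit_chart] by (simp add: metric_in_chart_eq[OF unit_chart(2)] unit_chart_def[symmetric])

lemma isCont_metric_in_chart: "isCont (\<lambda>x. metric_in_chart x v w) (snd unit_chart \<one>\<^bsub>G\<^esub>)"
proof -
  have "smooth_on (snd unit_chart ` fst unit_chart) (\<lambda>x. metric_in_chart x v w)"
    unfolding metric_in_chart_def using riemannian unit_chart unfolding riemannian_metric_def by blast
  from smooth_on_imp_continuous_on[OF this] show ?thesis
    using open_chart_image[OF unit_chart(1) open_chart_domain[OF unit_chart(1)]] unit_chart(2)
    by (simp add: continuous_on_eq_continuous_at)
qed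

text \<open>In the chart at the identity let \<open>L y v\<close> and \<open>R y v\<close> be the values at \<open>y\<close> of the left- and
  right-invariant fields through \<open>v\<close>. By bi-invariance both frames have the constant Gram matrix
  of \<open>g\<close> at the identity, so the difference of their derivatives is skew. With \<open>F\<close> the
  multiplication, the derivative of \<open>L v\<close> along \<open>u\<close> is \<open>\<partial>\<^sub>1\<partial>\<^sub>2F(u, v)\<close> and that of \<open>R v\<close> is
  \<open>\<partial>\<^sub>1\<partial>\<^sub>2F(v, u)\<close>; their difference is \<open>[u, v]\<close>.\<close>

lemma bracket_skew: "g \<one>\<^bsub>G\<^esub> (algebra_bracket G u v) w + g \<one>\<^bsub>G\<^esub> v (algebra_bracket G u w) = 0"
proof -
  define o1 where "o1 = snd unit_chart \<one>\<^bsub>G\<^esub>"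
  define S where "S = snd unit_chart ` fst unit_chart"
  define F where "F = mult_in_charts unit_chart unit_chart unit_chart"
  define W where "W = mult_domain unit_chart unit_chart unit_chart"
  define D where "D z h k = frechet_derivative (\<lambda>y. frechet_derivative F (at y) h) (at z) k" for z h k
  define L where "L y v = frechet_derivative F (at (y, o1)) (0, v)" for y v
  define R where "R y v = frechet_derivative F (at (o1, y)) (v, 0)" for y v
  have S: "open S" "o1 \<in> S"
    unfolding S_def o1_def using unit_chart open_chart_image[OF unit_chart(1) open_chart_domain[OF unit_chart(1)]] by auto
  have F: "smooth_on W F" "open W"
    unfolding F_def W_def by (rule smooth_mult_in_charts open_mult_domain unit_chart)+
  have o1: "(o1, o1) \<in> W" unfolding W_def mult_domain_def o1_def using unit_chart by force
  have DD: "((\<lambda>z. frechet_derivative F (at z) h) has_derivative D (o1, o1) h) (at (o1, o1))" for h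
    unfolding D_def using smooth_on_has_derivative[OF smooth_on_derivative[OF F] F(2) o1] by simp
  have dL: "((\<lambda>y. L y v) has_derivative (\<lambda>k. D (o1, o1) (0, v) (k, 0))) (at o1)" for v
    unfolding L_def
    by (rule has_derivative_compose[where f = "\<lambda>y. (y, o1)" and g = "\<lambda>z. frechet_derivative F (at z) (0, v)", OF _ DD])
      (auto intro!: derivative_eq_intros)
  have dR: "((\<lambda>y. R y v) has_derivative (\<lambda>k. D (o1, o1) (v, 0) (0, k))) (at o1)" for v
    unfolding R_def
    by (rule has_derivative_compose[where f = "\<lambda>y. (o1, y)" and g = "\<lambda>z. frechet_derivative F (at z) (v, 0)", OF _ DD])
      (auto intro!: derivative_eq_intros)
  have L: "L (snd unit_chart p) v = chart_derivative unit_chart unit_chart (\<lambda>x. p \<otimes>\<^bsub>G\<^esub> x) \<one>\<^bsub>G\<^esub> v"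
    and R: "R (snd unit_chart p) v = chart_derivative unit_chart unit_chart (\<lambda>x. x \<otimes>\<^bsub>G\<^esub> p) \<one>\<^bsub>G\<^esub> v"
    if "p \<in> fst unit_chart" for p v
    by (simp_all add: L_def R_def F_def o1_def left_translation_derivative right_translation_derivative
        unit_chart that)
  have id1: "chart_derivative unit_chart unit_chart (\<lambda>x. x) \<one>\<^bsub>G\<^esub> v = v" for v
    using chart_derivative_id[OF unit_chart, of v] by (simp add: id_def)
  have L1: "L o1 v = v" and R1: "R o1 v = v" for v
    using L[OF unit_chart(2)] R[OF unit_chart(2)] by (simp_all add: o1_def id1)
  have invL: "metric_in_chart (snd unit_chart p) (L (snd unit_chart p) v) (L (snd unit_chart p) w) = g \<one>\<^bsub>G\<^esub> v w"
    and invR: "metric_in_chart (snd unit_chart p) (R (snd unit_chart p) v) (R (snd unit_chart p) w) = g \<one>\<^bsub>G\<^esub> v w"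
    if p: "p \<in> fst unit_chart" for p v w
  proof -
    let ?c = "chart_at (atlas G) p"
    have "chart_derivative unit_chart ?c id p (L (snd unit_chart p) v)
        = tangent_map (atlas G) (atlas G) (\<lambda>x. p \<otimes>\<^bsub>G\<^esub> x) \<one>\<^bsub>G\<^esub> v" for v
      using chart_derivative_chain[OF smooth_map_id smooth_left_translation[of p]
          unit_chart(1) unit_chart(1) chart_at(1) unit_chart(2),
          of p "\<lambda>x. p \<otimes>\<^bsub>G\<^esub> x" v] p chart_at(2)[of p]
      by (simp add: L[OF p] tangent_map_def unit_chart_def[symmetric] chart_derivative_def)
    then show "metric_in_chart (snd unit_chart p) (L (snd unit_chart p) v) (L (snd unit_chart p) w) = g \<one>\<^bsub>G\<^esub> v w"
      using left_invariant[of p "\<one>\<^bsub>G\<^esub>" v w] by (simp add: metric_in_chart_eq[OF p])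
    have "chart_derivative unit_chart ?c id p (R (snd unit_chart p) v)
        = tangent_map (atlas G) (atlas G) (\<lambda>x. x \<otimes>\<^bsub>G\<^esub> p) \<one>\<^bsub>G\<^esub> v" for v
      using chart_derivative_chain[OF smooth_map_id smooth_right_translation[of p]
          unit_chart(1) unit_chart(1) chart_at(1) unit_chart(2),
          of p "\<lambda>x. x \<otimes>\<^bsub>G\<^esub> p" v] p chart_at(2)[of p]
      by (simp add: R[OF p] tangent_map_def unit_chart_def[symmetric] chart_derivative_def)
    then show "metric_in_chart (snd unit_chart p) (R (snd unit_chart p) v) (R (snd unit_chart p) w) = g \<one>\<^bsub>G\<^esub> v w"
      using right_invariant[of "\<one>\<^bsub>G\<^esub>" p v w] by (simp add: metric_in_chart_eq[OF p])
  qed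
  have L_field: "field_in_chart (atlas G) unit_chart (left_invariant_field G v) y = L y v" if "y \<in> S" for v y
    using that left_invariant_field_in_chart[OF unit_chart(1)] by (auto simp: S_def L)
  have field': "frechet_derivative (field_in_chart (atlas G) unit_chart (left_invariant_field G v)) (at o1) k
      = D (o1, o1) (0, v) (k, 0)" for v k
  proof -
    have "(field_in_chart (atlas G) unit_chart (left_invariant_field G v) has_derivative (\<lambda>k. D (o1, o1) (0, v) (k, 0))) (at o1)"
      by (rule has_derivative_transform_within_open[OF dL S]) (simp add: L_field)
    from frechet_derivative_at[OF this] show ?thesis by (rule fun_cong[OF sym])
  qed
  have br: "D (o1, o1) (0, v) (u, 0) - D (o1, o1) (v, 0) (0, u) = algebra_bracket G u v" for u v
  proof -
    have "D (o1, o1) (v, 0) (0, u) = D (o1, o1) (0, u) (v, 0)"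
      unfolding D_def by (rule smooth_on_second_derivative_symmetric[OF F o1])
    then show ?thesis
      by (simp add: algebra_bracket_def lie_bracket_def unit_chart_def[symmetric] o1_def[symmetric]
          field' left_invariant_field_one)
  qed
  have "metric_in_chart o1 (algebra_bracket G u v) w + metric_in_chart o1 v (algebra_bracket G u w) = 0"
    unfolding br[symmetric]
    by (rule skew_difference_of_isometric_frames[where L = L and R = R and b = metric_in_chart,
          OF S _ _ dL dR L1 R1])
      (auto simp: S_def o1_def bilinear_metric_in_chart invL invR isCont_metric_in_chart)
  then show ?thesis by (simp add: o1_def metric_in_chart_one)
qed

lemma algebra_bracket_anticommute: "algebra_bracket G u v = - algebra_bracket G v u"
  by (simp add: algebra_bracket_def lie_bracket_def left_invariant_field_one Let_def)

lemma metric_bracket_cyclic: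
  "g \<one>\<^bsub>G\<^esub> (algebra_bracket G u v) w = g \<one>\<^bsub>G\<^esub> (algebra_bracket G v w) u"
  using bracket_skew[of v u w] algebra_bracket_anticommute[of u v]
    metric_commute[of "\<one>\<^bsub>G\<^esub>" u "algebra_bracket G v w"]
  by (simp add: metric_linear)

text \<open>Write \<open>C(u, v, w) = \<langle>\<nabla>\<^sub>u v, w\<rangle>\<close> and \<open>b(u, v, w) = \<langle>[u, v], w\<rangle>\<close>. As scalar products of
  left-invariant fields are constant, metric compatibility makes \<open>C\<close> skew in its last two
  arguments; vanishing torsion says \<open>C(u, v, w) - C(v, u, w) = b(u, v, w)\<close>. Since \<open>b\<close> is cyclic,
  these linear equations have the solution \<open>2 C = b\<close> only.\<close>

lemma levi_civita_left_invariant: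
  assumes nabla: "levi_civita (atlas G) g nabla"
  shows "2 * g \<one>\<^bsub>G\<^esub> (to_algebra G p (nabla (left_invariant_field G u) (left_invariant_field G v) p)) w
    = g \<one>\<^bsub>G\<^esub> (algebra_bracket G u v) w"
proof -
  define C where "C u v w = g p (nabla (left_invariant_field G u) (left_invariant_field G v) p)
      (left_invariant_field G w p)" for u v w
  define b where "b u v w = g \<one>\<^bsub>G\<^esub> (algebra_bracket G u v) w" for u v w
  note sm = smooth_left_invariant_field
  have tor: "C u v w - C v u w = b u v w" for u v w
  proof -
    have "nabla (left_invariant_field G u) (left_invariant_field G v) p
        - nabla (left_invariant_field G v) (left_invariant_field G u) p
        = left_invariant_field G (algebra_bracket G u v) p"
      using nabla sm[of u] sm[of v] unfolding levi_civita_def lie_bracket_left_invariant[symmetric] by blast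
    then show ?thesis
      unfolding C_def b_def metric_left_invariant_field[of p, symmetric]
      by (metis bilinear_lsub[OF metric_bilinear])
  qed
  have met: "C u v w + C u w v = 0" for u v w
  proof -
    have "dir_deriv (atlas G) (left_invariant_field G u)
        (\<lambda>q. g q (left_invariant_field G v q) (left_invariant_field G w q)) p
        = g p (nabla (left_invariant_field G u) (left_invariant_field G v) p) (left_invariant_field G w p)
        + g p (left_invariant_field G v p) (nabla (left_invariant_field G u) (left_invariant_field G w) p)"
      using nabla sm[of u] sm[of v] sm[of w] unfolding levi_civita_def by blast
    moreover have "dir_deriv (atlas G) X (\<lambda>q. k) p = 0" for X and k :: real
      by (simp add: dir_deriv_def tangent_map_def comp_def)
    ultimately show ?thesis
      unfolding C_def metric_left_invariant_field
      by (simp add: metric_commute)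
  qed
  have cyc: "b u v w = b v w u" for u v w
    unfolding b_def by (rule metric_bracket_cyclic)
  have "2 * C u v w = b u v w"
    using tor[of u v w] met[of v u w] tor[of v w u] met[of w v u] tor[of w u v] met[of u w v]
      cyc[of u v w] cyc[of v w u] by linarith
  then show ?thesis by (simp add: C_def b_def metric_to_algebra)
qed

end

section \<open>The binormal and the left shift of the natural mate\<close>

text \<open>The functional \<open>b u\<close> is the scalar product with some vector \<open>a\<close>, which is then in the kernel
  of the invertible matrix with rows \<open>x\<close>, \<open>y\<close>, \<open>z\<close>.\<close>

lemma bilinear_form_orthogonal_to_basis3:
  fixes b :: "real^3 \<Rightarrow> real^3 \<Rightarrow> real"
  assumes b: "bilinear b" "\<And>v. v \<noteq> 0 \<Longrightarrow> b v v > 0"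
    and det: "det (vector [x, y, z] :: real^3^3) \<noteq> 0"
    and 0: "b u x = 0" "b u y = 0" "b u z = 0"
  shows "u = 0"
proof -
  let ?M = "vector [x, y, z] :: real^3^3"
  define a where "a = adjoint (b u) 1"
  have "linear (b u)" using b(1) by (simp add: bilinear_def)
  then have a: "v \<bullet> a = b u v" for v
    using adjoint_works[of "b u" v 1] by (simp add: a_def)
  have "?M *v a = 0"
    using 0 a by (simp add: vec_eq_iff forall_3 matrix_vector_mult_def inner_vec_def vector_3)
  moreover have "invertible ?M" using det by (simp add: invertible_det_nz)
  ultimately have "a = 0"
    by (metis invertible_def matrix_left_invertible_ker)
  then have "b u u = 0" using a[of u] by simp
  then show "u = 0" using b(2)[of u] by fastforce
qed

theorem theorem6p2:
  fixes G :: "('g::{t2_space, second_countable_topology}, real^3) lie_group_data"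
    and g :: "'g \<Rightarrow> real^3 \<Rightarrow> real^3 \<Rightarrow> real"
    and nabla :: "('g \<Rightarrow> real^3) \<Rightarrow> ('g \<Rightarrow> real^3) \<Rightarrow> 'g \<Rightarrow> real^3"
    and E :: "real^3^3"
    and I :: "real set"
    and \<gamma> \<beta> :: "real \<Rightarrow> 'g"
    and T N B :: "real \<Rightarrow> real^3"
    and \<kappa> \<tau> :: "real \<Rightarrow> real"
    and c :: real
  assumes "lie_group G"
    and "bi_invariant_metric G g"
    and "levi_civita (atlas G) g nabla"
    and "det E \<noteq> 0"
    and "is_interval I" and "interior I \<noteq> {}"
    and "frenet_curve G g nabla E I \<gamma> T N B \<kappa> \<tau>"
    and "natural_mate G g nabla E I N \<beta>"
    and "\<And>s. s \<in> I \<Longrightarrow> \<tau> s - group_torsion G g T N B s = c"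
    and "c \<noteq> 0"
  shows "spherical_with_radius G g I \<beta> (1 / \<bar>c\<bar>)"
proof -
  interpret bi_invariant_lie_group G g
    using assms(1,2) by unfold_locales
  have frenet: "frenet_apparatus G g nabla E I \<gamma> T N B \<kappa> \<tau>"
    using assms(7) by (simp add: frenet_curve_def)
  have smooth_B: "smooth_on I B" using frenet by (simp add: frenet_apparatus_def)
  have dB: "(B has_vector_derivative - c *\<^sub>R N s) (at s within I)" if s: "s \<in> I" for s
  proof -
    note fr = frenet[unfolded frenet_apparatus_def, THEN conjunct2, THEN conjunct2,
        THEN conjunct2, THEN bspec, OF s]
    \<comment> \<open>The part of the covariant derivative of \<open>B\<close> due to the connection, that is, \<open>[T, B]/2\<close>.\<close>
    define W where "W = to_algebra G (\<gamma> s)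
        (nabla (left_invariant_field G (T s)) (left_invariant_field G (B s)) (\<gamma> s))"
    have W: "g \<one>\<^bsub>G\<^esub> W v = g \<one>\<^bsub>G\<^esub> (algebra_bracket G (T s) (B s)) v / 2" for v
      using levi_civita_left_invariant[OF assms(3), of "\<gamma> s" "T s" "B s" v] by (simp add: W_def)
    define \<tau>G where "\<tau>G = group_torsion G g T N B s"
    have TT: "algebra_bracket G v v = 0" for v
      by (simp add: algebra_bracket_def lie_bracket_def Let_def)
    have z: "g \<one>\<^bsub>G\<^esub> 0 v = 0" "g \<one>\<^bsub>G\<^esub> v 0 = 0" for v
      using bilinear_lzero[OF metric_bilinear] bilinear_rzero[OF metric_bilinear] by auto
    have WT: "g \<one>\<^bsub>G\<^esub> W (T s) = 0"
      using bracket_skew[of "T s" "B s" "T s"] by (simp add: W TT z)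
    have WB: "g \<one>\<^bsub>G\<^esub> W (B s) = 0"
      using bracket_skew[of "T s" "B s" "B s"] by (simp add: W metric_commute)
    have WN: "g \<one>\<^bsub>G\<^esub> W (N s) = - \<tau>G"
      using bracket_skew[of "T s" "B s" "N s"]
      by (simp add: W \<tau>G_def group_torsion_def metric_commute[of _ "B s"])
    have orth: "g \<one>\<^bsub>G\<^esub> (N s) (N s) = 1" "g \<one>\<^bsub>G\<^esub> (N s) (T s) = 0" "g \<one>\<^bsub>G\<^esub> (N s) (B s) = 0"
      using fr metric_commute[of "\<one>\<^bsub>G\<^esub>" "N s" "T s"] by auto
    \<comment> \<open>Both \<open>W\<close> and \<open>- \<tau>G N\<close> have the same scalar products with the Frenet frame, a basis by its
      orientation.\<close>
    have "W + \<tau>G *\<^sub>R N s = 0"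
    proof (rule bilinear_form_orthogonal_to_basis3[OF metric_bilinear[of "\<one>\<^bsub>G\<^esub>"] metric_pos])
      show "det (vector [T s, N s, B s] :: real^3^3) \<noteq> 0"
        using fr by (auto simp: positively_oriented_def)
    qed (simp_all add: metric_linear WT WN WB orth)
    then have W_eq: "W = - \<tau>G *\<^sub>R N s" by (simp add: eq_neg_iff_add_eq_0)
    have "vector_derivative B (at s within I) + W = - \<tau> s *\<^sub>R N s"
      using fr by (simp add: cov_deriv_along_def W_def)
    then have "vector_derivative B (at s within I) = - (\<tau> s - \<tau>G) *\<^sub>R N s"
      unfolding W_eq by (simp add: algebra_simps)
    also have "\<dots> = - c *\<^sub>R N s" using assms(9)[OF s] by (simp add: \<tau>G_def)
    finally show ?thesis
      using smooth_on_imp_differentiable[OF smooth_B s] by (simp add: vector_derivative_works)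
  qed
  define \<alpha> where "\<alpha> s = (- 1 / c) *\<^sub>R B s" for s
  have "left_shift G I \<beta> \<alpha>"
    unfolding left_shift_def
  proof (intro conjI ballI)
    show "smooth_on I \<alpha>" unfolding \<alpha>_def by (rule smooth_on_scaleR_const[OF smooth_B])
    fix s assume s: "s \<in> I"
    have "algebra_velocity G I \<beta> s = N s"
      using assms(8) s by (auto simp: natural_mate_def frenet_apparatus_def)
    then show "(\<alpha> has_vector_derivative algebra_velocity G I \<beta> s) (at s within I)"
      unfolding \<alpha>_def
      using bounded_linear.has_vector_derivative[OF bounded_linear_scaleR_right dB[OF s], of "- 1 / c"] assms(10)
      by simp
  qed
  moreover have "g \<one>\<^bsub>G\<^esub> (\<alpha> s) (\<alpha> s) = (1 / \<bar>c\<bar>)\<^sup>2" if "s \<in> I" for s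
    using frenet that by (simp add: \<alpha>_def metric_linear frenet_apparatus_def power2_eq_square)
  ultimately show ?thesis unfolding spherical_with_radius_def by blast
qed

end
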